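(* Let $n\ge1$, let $\mathbb{B}=\{z\in\mathbb{C}^n:|z|<1\}$, $\mathbb{S}=\partial\mathbb{B}$, and let $q\in\mathbb{R}$, $q>1$. Then the set $$\mathcal{A}_q=\Big\{g\in\bigcap_{1\le p<q}H^p(\mathbb{B}) : g\notin H^q(\mathbb{B},\mathbb{S}\cap B(\zeta,\varepsilon))\text{ for any }\zeta\in\mathbb{S}\text{ and any }\varepsilon>0\Big\}$$ is dense and $\mathcal{G}_\delta$ in the space $\bigcap_{1\le p<q}H^p(\mathbb{B})$.
   Context: $d\sigma$ is the Euclidean surface area measure on $\mathbb{S}$ and $B(\zeta,\varepsilon)=\{z\in\mathbb{C}^n:|z-\zeta|<\varepsilon\}$. For $1\le p<\infty$, $H^p(\mathbb{B})$ is the Banach space of holomorphic functions $f:\mathbb{B}\to\mathbb{C}$ such that $\|f\|_p=\sup_{0<r<1}\left(\int_{\mathbb{S}}|f(r\zeta)|^p\,d\sigma(\zeta)\right)^{1/p}<\infty$. The space $\bigcap_{1\le p<q}H^p(\mathbb{B})$ is a complete metric space with the metric $d(f,g)=\sum_{j=1}^\infty 2^{-j}\frac{\|f-g\|_{p_j}}{1+\|f-g\|_{p_j}}$, where $1<p_1<p_2<\cdots<q$ and $p_j\to q$; the topology does not depend on the choice of $(p_j)$, and $f_k\to f$ if and only if $\|f_k-f\|_p\to0$ for every $1\le p<q$. Local Hardy spaces: for a non-empty (relatively) open set $G\subset\mathbb{S}$ and $1\le p<\infty$, a holomorphic function $f:\mathbb{B}\to\mathbb{C}$ belongs to $H^p(\mathbb{B},G)$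 if $\sup_{0<r<1}\int_{z\in G}|f(rz)|^p\,d\sigma(z)<\infty$. *)

theory Defs
  imports "HOL-Analysis.Analysis"
begin

text \<open>
  Euclidean surface area on the unit sphere of a \<open>d\<close>-dimensional Euclidean space, introduced via
  polar coordinates: the area of \<open>A\<close> is \<open>d\<close> times the Lebesgue measure of the (punctured) cone
  \<open>{t *\<^sub>R x | 0 < t < 1, x \<in> A}\<close>, the factor \<open>d\<close> coming from \<open>\<integral> t\<^sup>d\<^sup>-\<^sup>1 dt = 1/d\<close> over \<open>(0,1)\<close>.
  It is not normalised: the total mass is \<open>d\<close> times the volume of the unit ball.
\<close>

definition surface_measure :: "'a::euclidean_space measure" where
  "surface_measure =
     scale_measure (of_nat DIM('a))
       (distr (restrict_space lborel (ball 0 1 - {0})) (restrict_space borel (sphere 0 1)) sgn)"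

lemma space_surface_measure [simp]:
  "space (surface_measure :: 'a::euclidean_space measure) = sphere 0 1"
proof -
  have "sets (surface_measure :: 'a measure) = sets (restrict_space borel (sphere 0 1))"
    by (simp add: surface_measure_def)
  from sets_eq_imp_space_eq[OF this] show ?thesis by (simp add: space_restrict_space)
qed

lemma sets_surface_measure [simp, measurable_cong]:
  "sets (surface_measure :: 'a::euclidean_space measure) = sets (restrict_space borel (sphere 0 1))"
  by (simp add: surface_measure_def)

lemma emeasure_surface_measure:
  fixes A :: "'a::euclidean_space set"
  assumes "A \<in> sets borel" "A \<subseteq> sphere 0 1"
  shows "emeasure surface_measure A =
           of_nat DIM('a) * emeasure lborel {t *\<^sub>R x | t x. 0 < t \<and> t < 1 \<and> x \<in> A}"
proof -
  let ?B = "ball 0 1 - {0::'a}"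
  have sgn: "sgn \<in> restrict_space lborel ?B \<rightarrow>\<^sub>M restrict_space borel (sphere 0 (1::real))"
    by (intro measurable_restrict_space3) (auto simp: norm_sgn)
  have cone: "sgn -` A \<inter> ?B = {t *\<^sub>R x | t x. 0 < t \<and> t < 1 \<and> x \<in> A}"
  proof (intro equalityI subsetI)
    fix y assume "y \<in> sgn -` A \<inter> ?B"
    then have "0 < norm y \<and> norm y < 1 \<and> sgn y \<in> A" and "y = norm y *\<^sub>R sgn y"
      by (auto simp: sgn_div_norm)
    then show "y \<in> {t *\<^sub>R x | t x. 0 < t \<and> t < 1 \<and> x \<in> A}" by blast
  next
    fix y assume "y \<in> {t *\<^sub>R x | t x. 0 < t \<and> t < 1 \<and> x \<in> A}"
    then obtain t x where "y = t *\<^sub>R x" "0 < t" "t < 1" "x \<in> A" "norm x = 1"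
      using assms(2) by (auto simp: subset_iff)
    then show "y \<in> sgn -` A \<inter> ?B"
      by (auto simp: sgn_scaleR) (auto simp: sgn_div_norm)
  qed
  have "A \<in> sets (restrict_space borel (sphere 0 1))"
    using assms by (auto simp: sets_restrict_space)
  then show ?thesis
    using sgn
    by (simp add: surface_measure_def emeasure_distr space_restrict_space cone
        emeasure_restrict_space flip: cone)
qed

text \<open>
  Holomorphy in several variables: real Frechet differentiability with a complex-linear derivative.
\<close>

definition holomorphic_several :: "(complex ^ 'n \<Rightarrow> complex) \<Rightarrow> (complex ^ 'n) set \<Rightarrow> bool" where
  "holomorphic_several f S \<longleftrightarrow>
     (\<forall>z\<in>S. \<exists>a. (f has_derivative (\<lambda>h. \<Sum>i\<in>UNIV. a $ i * h $ i)) (at z within S))"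

text \<open>
  Functions on the ball are represented extensionally, so that distinct elements of the spaces
  below really are distinct functions on the ball.
\<close>

definition holomorphic_on_ball :: "(complex ^ 'n \<Rightarrow> complex) set" where
  "holomorphic_on_ball = {f \<in> extensional (ball 0 1). holomorphic_several f (ball 0 1)}"

text \<open>
  The supremum is taken in \<open>[0, \<infinity>]\<close>. The inner integrals are integrals of continuous functions
  over the compact sphere as soon as \<open>f\<close> is continuous on the ball.
\<close>

definition hardy_norm :: "real \<Rightarrow> (complex ^ 'n \<Rightarrow> complex) \<Rightarrow> ennreal" where
  "hardy_norm p f =
     (SUP r\<in>{0<..<1}. ennreal ((\<integral>z. norm (f (r *\<^sub>R z)) powr p \<partial>surface_measure) powr (1 / p)))"

definition hardy_space :: "real \<Rightarrow> (complex ^ 'n \<Rightarrow> complex) set" where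
  "hardy_space p = {f \<in> holomorphic_on_ball. hardy_norm p f < \<infinity>}"

definition local_hardy_space :: "real \<Rightarrow> (complex ^ 'n) set \<Rightarrow> (complex ^ 'n \<Rightarrow> complex) set" where
  "local_hardy_space p G =
     {f \<in> holomorphic_on_ball.
        (SUP r\<in>{0<..<1}. ennreal (LINT z:G|surface_measure. norm (f (r *\<^sub>R z)) powr p)) < \<infinity>}"

definition hardy_inter :: "real \<Rightarrow> (complex ^ 'n \<Rightarrow> complex) set" where
  "hardy_inter q = (\<Inter>p\<in>{1..<q}. hardy_space p)"

text \<open>The exponents are indexed from \<open>0\<close>, hence the weight \<open>2\<^sup>-\<^sup>(\<^sup>j\<^sup>+\<^sup>1\<^sup>)\<close>.\<close>

definition hardy_dist ::
  "(nat \<Rightarrow> real) \<Rightarrow> (complex ^ 'n \<Rightarrow> complex) \<Rightarrow> (complex ^ 'n \<Rightarrow> complex) \<Rightarrow> real" where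
  "hardy_dist p f g =
     (\<Sum>j. (1 / 2) ^ Suc j *
        (let N = enn2real (hardy_norm (p j) (\<lambda>z. f z - g z)) in N / (1 + N)))"

abbreviation hardy_topology ::
  "(nat \<Rightarrow> real) \<Rightarrow> real \<Rightarrow> (complex ^ 'n \<Rightarrow> complex) topology" where
  "hardy_topology p q \<equiv> Metric_space.mtopology (hardy_inter q) (hardy_dist p)"

definition nowhere_local_hardy :: "real \<Rightarrow> (complex ^ 'n \<Rightarrow> complex) set" where
  "nowhere_local_hardy q =
     {g \<in> hardy_inter q.
        \<forall>\<zeta>\<in>sphere 0 1. \<forall>\<epsilon>>0. g \<notin> local_hardy_space q (sphere 0 1 \<inter> ball \<zeta> \<epsilon>)}"

end

theory Submission
  imports Defs
begin

text \<open>
  A set \<open>{f. \<integral>\<^sub>G |f (r z)|\<^sup>q d\<sigma> > M}\<close> is open because \<open>a\<^sup>q - b\<^sup>q \<le> q a\<^sup>q\<^sup>-\<^sup>1 (a - b)\<close>, and countably many caps \<open>G\<close>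
  suffice, so the set in question is \<open>G\<^sub>\<delta>\<close>. For density no completeness is needed: if \<open>h\<close> is one
  element of the set, then \<open>f + t h\<close> lies in \<open>H\<^sup>q(G)\<close> for at most one \<open>t\<close> per cap \<open>G\<close>, hence \<open>f + t h\<close> is in the
  set for all but countably many \<open>t\<close>.

  Such an \<open>h\<close> is a gliding hump series of functions \<open>A ((1 + \<langle>z, \<zeta>\<rangle>) / 2)\<^sup>x\<close> peaking at \<open>\<zeta>\<close>. That they can
  be small in \<open>L\<^sup>p\<close> and large in \<open>L\<^sup>q\<close> for \<open>p < q\<close> follows without asymptotics of the integrals
  \<open>I(t) = \<integral> m\<^sup>t\<close>, \<open>m\<close> being the modulus of the peak function: otherwise \<open>I(\<theta> t) \<le> D I(t)\<^sup>\<theta>\<close> with \<open>\<theta> = q / p\<close>,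
  and iterating this from a \<open>t\<close> with \<open>I(t)\<close> small makes \<open>I\<close> decay exponentially, although \<open>I(t)\<close> is at least
  a constant times \<open>k\<^sup>t\<close> for every \<open>k < 1\<close>.
\<close>

section \<open>Powers and the surface measure\<close>

text \<open>The hump has to meet opposing demands. Its modulus must have a single peak on the
  sphere, although the modulus of \<open>cip z \<zeta>\<close> equals 1 on a whole circle through
  \<zeta>; adding 1 singles out \<zeta> and keeps the base in the right half-plane, where complex
  powers are holomorphic. Once the L^p bound fixes the amplitude, only the exponent x is free: large
  x makes the hump and its gradient small on any given smaller ball, so the growth argument has to
  produce arbitrarily large x. Each hump is bounded on the ball, hence the later ones can be chosen
  to outweigh it. The exponent p of the n-th hump increases to q with n, because the sum must lie in
  H^p for every p < q at once. The local Hardy spaces see only slices of radius r < 1, so largeness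
  on the boundary sphere is carried inside by continuity in the radius. Openness is checked on one
  slice, where f is bounded and the L^1 distance is controlled by a single norm of the
  metric.\<close>

lemma powr_tangent_le:
  fixes a b q :: real
  assumes "0 \<le> a" "0 \<le> b" "1 \<le> q"
  shows "a powr q - b powr q \<le> q * a powr (q - 1) * (a - b)"
proof -
  have eq: "a powr (q - 1) * a = a powr q"
  proof (cases "a = 0")
    case False
    then have "a * a powr (q - 1) = a powr q" using assms by (simp add: powr_mult_base)
    then show ?thesis by (simp only: mult.commute)
  qed simp
  show ?thesis
  proof (cases "a = 0 \<or> b = 0")
    case True
    then show ?thesis
    proof
      assume "b = 0"
      have "1 * a powr q \<le> q * a powr q" using assms by (intro mult_right_mono) auto
      then show ?thesis using \<open>b = 0\<close> eq by (simp add: mult.assoc)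
    qed simp
  next
    case False
    \<comment> \<open>Weighted AM-GM for \<open>b powr q\<close> and \<open>a powr q\<close> with
      weights 1/q and 1 - 1/q; multiplied by q it is the tangent inequality.\<close>
    have "(b powr q) powr (1 / q) * (a powr q) powr (1 - 1 / q) \<le> (1 / q) * b powr q + (1 - 1 / q) * a powr q"
      using assms False by (intro Youngs_inequality_0) auto
    moreover have "(b powr q) powr (1 / q) = b" "(a powr q) powr (1 - 1 / q) = a powr (q - 1)"
      using assms by (auto simp: powr_powr right_diff_distrib)
    ultimately have "b * a powr (q - 1) \<le> (1 / q) * b powr q + (1 - 1 / q) * a powr q" by simp
    then have "q * (b * a powr (q - 1)) \<le> q * ((1 / q) * b powr q + (1 - 1 / q) * a powr q)"
      using assms by (intro mult_left_mono) auto
    also have "\<dots> = b powr q + (q - 1) * a powr q" using assms by (simp add: field_simps)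
    finally show ?thesis using eq by (simp add: algebra_simps)
  qed
qed

text \<open>Tangents taken at the mean \<open>c\<close>: after weighting, the linear terms
  cancel.\<close>

lemma powr_convex_combination_le:
  fixes a b u v p :: real
  assumes "0 \<le> a" "0 \<le> b" "0 \<le> u" "0 \<le> v" "u + v = 1" "1 \<le> p"
  shows "(u * a + v * b) powr p \<le> u * a powr p + v * b powr p"
proof -
  define c where "c = u * a + v * b"
  have c: "0 \<le> c" using assms by (simp add: c_def)
  have "u * (c powr p - a powr p) + v * (c powr p - b powr p)
      \<le> u * (p * c powr (p - 1) * (c - a)) + v * (p * c powr (p - 1) * (c - b))"
    using assms c by (intro add_mono mult_left_mono powr_tangent_le) auto
  also have "\<dots> = p * c powr (p - 1) * ((u + v) * c - (u * a + v * b))" by (simp add: algebra_simps)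
  also have "\<dots> = 0" using assms(5) by (simp add: c_def)
  finally have "(u + v) * c powr p \<le> u * a powr p + v * b powr p" by (simp add: algebra_simps)
  then show ?thesis using assms(5) by (simp add: c_def)
qed

lemma powr_add_le:
  fixes a b p :: real
  assumes "0 \<le> a" "0 \<le> b" "0 \<le> p"
  shows "(a + b) powr p \<le> 2 powr p * (a powr p + b powr p)"
proof -
  have "(a + b) powr p \<le> (2 * max a b) powr p" using assms by (intro powr_mono2) auto
  also have "\<dots> = 2 powr p * (max a b) powr p" using assms by (simp add: powr_mult)
  also have "\<dots> \<le> 2 powr p * (a powr p + b powr p)"
    by (intro mult_left_mono) (auto simp: max_def)
  finally show ?thesis .
qed

text \<open>Cut at height \<open>l\<close>: below it the first term dominates, above it the second.
  Integrated over a finite measure, this bounds a lower power by a higher one.\<close>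

lemma powr_interpolation_le:
  fixes a l s p :: real
  assumes "0 \<le> a" "0 < l" "0 \<le> s" "s \<le> p"
  shows "a powr s \<le> l powr s + l powr (s - p) * a powr p"
proof (cases "a \<le> l")
  case True
  then have "a powr s \<le> l powr s" using assms by (intro powr_mono2) auto
  then show ?thesis by (simp add: add_increasing2)
next
  case False
  have "a powr s = a powr (s - p) * a powr p" using False assms by (simp add: powr_diff)
  also have "\<dots> \<le> l powr (s - p) * a powr p"
    using False assms by (intro mult_right_mono powr_mono2') auto
  finally show ?thesis by (simp add: add_increasing)
qed

text \<open>Convexity applied to \<open>f / a\<close> and \<open>g / b\<close> with weights a/(a+b)
  and b/(a+b). Arbitrary positive bounds \<open>a\<close>, \<open>b\<close> stand in for the norms,
  so no norm is ever divided by.\<close>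

lemma Minkowski_powr_le:
  fixes f g :: "'x \<Rightarrow> 'b::{real_normed_vector, second_countable_topology}"
  assumes [measurable]: "f \<in> borel_measurable M" "g \<in> borel_measurable M"
    and f: "integrable M (\<lambda>x. norm (f x) powr p)" "(\<integral>x. norm (f x) powr p \<partial>M) \<le> a powr p"
    and g: "integrable M (\<lambda>x. norm (g x) powr p)" "(\<integral>x. norm (g x) powr p \<partial>M) \<le> b powr p"
    and pos: "0 < a" "0 < b" "1 \<le> p"
  shows "(\<integral>x. norm (f x + g x) powr p \<partial>M) \<le> (a + b) powr p"
proof -
  let ?h = "\<lambda>x. (a + b) powr p * (a / (a + b) * (norm (f x) powr p / a powr p)
      + b / (a + b) * (norm (g x) powr p / b powr p))"
  have le: "norm (f x + g x) powr p \<le> ?h x" for x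
  proof -
    have "norm (f x + g x) powr p \<le> (norm (f x) + norm (g x)) powr p"
      using pos by (intro powr_mono2) (auto intro: norm_triangle_ineq)
    also have "norm (f x) + norm (g x)
        = (a + b) * (a / (a + b) * (norm (f x) / a) + b / (a + b) * (norm (g x) / b))"
    proof -
      have "a / (a + b) * (norm (f x) / a) = norm (f x) / (a + b)" "b / (a + b) * (norm (g x) / b) = norm (g x) / (a + b)"
        using pos by simp_all
      moreover have "a + b \<noteq> 0" using pos by linarith
      ultimately show ?thesis by (simp add: distrib_left)
    qed
    also have "\<dots> powr p
        = (a + b) powr p * (a / (a + b) * (norm (f x) / a) + b / (a + b) * (norm (g x) / b)) powr p"
      using pos by (intro powr_mult)
    also have "\<dots> \<le> (a + b) powr p * (a / (a + b) * (norm (f x) / a) powr p + b / (a + b) * (norm (g x) / b) powr p)"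
      using pos by (intro mult_left_mono powr_convex_combination_le)
        (simp_all add: add_divide_distrib[symmetric] del: times_divide_eq_left)
    finally show ?thesis using pos by (simp add: powr_divide)
  qed
  have int: "integrable M ?h" using f g by auto
  have "(\<integral>x. norm (f x + g x) powr p \<partial>M) \<le> (\<integral>x. ?h x \<partial>M)"
  proof (intro integral_mono le int)
    show "integrable M (\<lambda>x. norm (f x + g x) powr p)"
    proof (rule Bochner_Integration.integrable_bound[OF int])
      show "AE x in M. norm (norm (f x + g x) powr p) \<le> norm (?h x)"
        unfolding real_norm_def abs_of_nonneg[OF powr_ge_zero]
        by (intro AE_I2 order_trans[OF le abs_ge_self])
    qed measurable
  qed
  also have "\<dots> = (a + b) powr p * (a / (a + b) * ((\<integral>x. norm (f x) powr p \<partial>M) / a powr p)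
      + b / (a + b) * ((\<integral>x. norm (g x) powr p \<partial>M) / b powr p))"
    using f g by simp
  also have "\<dots> \<le> (a + b) powr p * (a / (a + b) * 1 + b / (a + b) * 1)"
    using f g pos by (intro mult_left_mono add_mono) (simp_all del: times_divide_eq_left)
  also have "a / (a + b) * 1 + b / (a + b) * 1 = 1"
    using pos add_divide_distrib[of a b "a + b"] by simp
  finally show ?thesis by simp
qed

section \<open>Surface measure: finiteness, caps, single points, continuous integrands\<close>

lemma finite_measure_surface_measure:
  "finite_measure (surface_measure :: 'a::euclidean_space measure)"
proof
  have "{t *\<^sub>R x | t x. 0 < t \<and> t < 1 \<and> x \<in> sphere 0 1} \<subseteq> ball (0::'a) 1"
    by auto
  then have "emeasure lborel {t *\<^sub>R x | t x. 0 < t \<and> t < 1 \<and> x \<in> sphere (0::'a) 1} \<le> emeasure lborel (ball (0::'a) 1)"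
    by (intro emeasure_mono) auto
  also have "\<dots> < \<infinity>" using emeasure_bounded_finite[of "ball (0::'a) 1"] by auto
  finally have "emeasure surface_measure (sphere (0::'a) 1) < \<infinity>"
    by (subst emeasure_surface_measure) (auto simp: ennreal_mult_less_top of_nat_less_top)
  then show "emeasure surface_measure (space (surface_measure :: 'a measure)) \<noteq> \<infinity>"
    by auto
qed

interpretation surface: finite_measure "surface_measure :: 'a::euclidean_space measure"
  by (rule finite_measure_surface_measure)

lemma sets_surface_measure_cap [measurable]:
  "A \<in> sets borel \<Longrightarrow> sphere 0 1 \<inter> A \<in> sets (surface_measure :: 'a::euclidean_space measure)"
  by (auto simp: sets_restrict_space)

text \<open>The cone over the cap contains a small ball around \<zeta>/2, which has positive
  volume.\<close>

lemma surface_measure_cap_pos: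
  fixes \<zeta> :: "'a::euclidean_space"
  assumes \<zeta>: "norm \<zeta> = 1" and e: "0 < e"
  shows "0 < measure surface_measure (sphere 0 1 \<inter> ball \<zeta> e)"
proof -
  \<comment> \<open>1/4 keeps the ball inside the punctured unit ball. Half the distance from
    \<open>sgn y\<close> to \<zeta> is below 2 d, so e/4 puts \<open>sgn y\<close> into the
    cap.\<close>
  define d where "d = min (1/4) (e / 4)"
  have d: "0 < d" "d \<le> 1/4" "4 * d \<le> e" using e by (auto simp: d_def)
  have "ball ((1/2) *\<^sub>R \<zeta>) d \<subseteq> {t *\<^sub>R x | t x. 0 < t \<and> t < 1 \<and> x \<in> sphere 0 1 \<inter> ball \<zeta> e}"
  proof
    fix y assume "y \<in> ball ((1/2) *\<^sub>R \<zeta>) d"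
    then have y: "norm (y - (1/2) *\<^sub>R \<zeta>) < d" by (simp add: dist_norm norm_minus_commute)
    have h: "norm ((1/2) *\<^sub>R \<zeta>) = 1/2" using \<zeta> by simp
    have ny: "\<bar>norm y - 1/2\<bar> < d" using norm_triangle_ineq3[of y "(1/2) *\<^sub>R \<zeta>"] y h by linarith
    then have ny': "1/4 < norm y" "norm y < 1" using d by linarith+
    define x where "x = sgn y"
    have x: "norm x = 1" using ny' by (auto simp: x_def norm_sgn)
    have "norm y \<noteq> 0" using ny' by linarith
    then have yx: "y = norm y *\<^sub>R x" by (simp add: x_def sgn_div_norm)
    have "(1/2) * norm (x - \<zeta>) = norm ((1/2) *\<^sub>R x - (1/2) *\<^sub>R \<zeta>)"
      by (simp add: scaleR_diff_right[symmetric])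
    also have "\<dots> \<le> norm ((1/2) *\<^sub>R x - y) + norm (y - (1/2) *\<^sub>R \<zeta>)"
      using norm_triangle_ineq[of "(1/2) *\<^sub>R x - y" "y - (1/2) *\<^sub>R \<zeta>"] by simp
    also have "(1/2) *\<^sub>R x - y = (1/2 - norm y) *\<^sub>R x"
      using yx by (metis scaleR_diff_left)
    also have "norm \<dots> = \<bar>norm y - 1/2\<bar>" using x by simp
    finally have "norm (x - \<zeta>) < e" using ny y d by linarith
    then have "x \<in> sphere 0 1 \<inter> ball \<zeta> e" using x by (simp add: dist_norm norm_minus_commute)
    moreover have "0 < norm y" using ny' by linarith
    ultimately show "y \<in> {t *\<^sub>R x | t x. 0 < t \<and> t < 1 \<and> x \<in> sphere 0 1 \<inter> ball \<zeta> e}"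
      using yx ny' by blast
  qed
  moreover have "{t *\<^sub>R x | t x. 0 < t \<and> t < 1 \<and> x \<in> sphere 0 1 \<inter> ball \<zeta> e} \<in> sets lborel"
  proof -
    have "{t *\<^sub>R x | t x. 0 < t \<and> t < 1 \<and> x \<in> sphere 0 1 \<inter> ball \<zeta> e} = sgn -` ball \<zeta> e \<inter> (ball 0 1 - {0})"
    proof (intro equalityI subsetI)
      fix y assume "y \<in> sgn -` ball \<zeta> e \<inter> (ball 0 1 - {0})"
      then have "0 < norm y \<and> norm y < 1 \<and> sgn y \<in> sphere 0 1 \<inter> ball \<zeta> e" and "y = norm y *\<^sub>R sgn y"
        by (auto simp: sgn_div_norm)
      then show "y \<in> {t *\<^sub>R x | t x. 0 < t \<and> t < 1 \<and> x \<in> sphere 0 1 \<inter> ball \<zeta> e}" by blast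
    next
      fix y assume "y \<in> {t *\<^sub>R x | t x. 0 < t \<and> t < 1 \<and> x \<in> sphere 0 1 \<inter> ball \<zeta> e}"
      then obtain t x where "y = t *\<^sub>R x" "0 < t" "t < 1" "x \<in> ball \<zeta> e" "norm x = 1"
        by (auto simp: subset_iff)
      then show "y \<in> sgn -` ball \<zeta> e \<inter> (ball 0 1 - {0})"
        by (auto simp: sgn_scaleR) (auto simp: sgn_div_norm)
    qed
    also have "\<dots> \<in> sets borel"
    proof -
      have "sgn \<in> borel_measurable (borel :: 'a measure)"
        unfolding sgn_div_norm[abs_def] by measurable
      from measurable_sets[OF this, of "ball \<zeta> e"] have "sgn -` ball \<zeta> e \<in> sets (borel :: 'a measure)"
        by simp
      then show ?thesis by auto
    qed
    finally show ?thesis by simp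
  qed
  ultimately have "emeasure lborel (ball ((1/2) *\<^sub>R \<zeta>) d)
      \<le> emeasure lborel {t *\<^sub>R x | t x. 0 < t \<and> t < 1 \<and> x \<in> sphere 0 1 \<inter> ball \<zeta> e}"
    by (intro emeasure_mono)
  moreover have "0 < emeasure lborel (ball ((1/2) *\<^sub>R \<zeta>) d)"
    using d by (simp add: emeasure_ball ennreal_zero_less_mult_iff unit_ball_vol_pos zero_less_power)
  ultimately have "0 < emeasure surface_measure (sphere 0 1 \<inter> ball \<zeta> e)"
    by (subst emeasure_surface_measure) (auto simp: ennreal_zero_less_mult_iff)
  then show ?thesis
    by (simp add: surface.emeasure_eq_measure)
qed

text \<open>The cone over a point lies in a real line, which is null from real dimension 2 on; this
  covers one complex variable.\<close>

lemma surface_measure_singleton: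
  fixes \<zeta> :: "'a::euclidean_space"
  assumes \<zeta>: "norm \<zeta> = 1" and dim: "2 \<le> DIM('a)"
  shows "{\<zeta>} \<in> null_sets surface_measure"
proof (intro null_setsI)
  let ?C = "{t *\<^sub>R x | t x. 0 < t \<and> t < 1 \<and> x \<in> {\<zeta>}}"
  have "dim (span {\<zeta>}) \<le> 1" using dim_le_card'[of "{\<zeta>}"] by (simp add: dim_span)
  then have neg: "negligible (span {\<zeta>})"
    using dim by (intro negligible_lowdim) linarith
  have sub: "?C \<subseteq> span {\<zeta>}"
    by (auto intro: span_mul span_base)
  have meas: "span {\<zeta>} \<in> sets lborel" using closed_subspace[OF subspace_span, of "{\<zeta>}"] by simp
  have "span {\<zeta>} \<in> null_sets lebesgue" using neg by (simp only: negligible_iff_null_sets)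
  then have "emeasure lborel (span {\<zeta>}) = 0" using null_sets_completion_iff[OF meas] by (simp only: null_setsD1)
  with emeasure_mono[OF sub meas] have C: "emeasure lborel ?C = 0"
    by (simp only: le_zero_eq)
  have "emeasure surface_measure {\<zeta>} = of_nat DIM('a) * emeasure lborel ?C"
    using \<zeta> by (intro emeasure_surface_measure) simp_all
  then show "emeasure surface_measure {\<zeta>} = 0"
    by (simp only: C mult_zero_right)
  show "{\<zeta>} \<in> sets surface_measure" 
    using sets_surface_measure_cap[of "{\<zeta>}"] \<zeta> by simp
qed

lemma borel_measurable_surface_continuous_on:
  fixes f :: "'a::euclidean_space \<Rightarrow> 'b::topological_space"
  assumes "continuous_on (sphere 0 1) f"
  shows "f \<in> borel_measurable surface_measure"
  using borel_measurable_continuous_on_restrict[OF assms]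
    measurable_cong_sets[OF sets_surface_measure refl] by blast

lemma integrable_surface_continuous_on:
  fixes f :: "'a::euclidean_space \<Rightarrow> real"
  assumes "continuous_on (sphere 0 1) f"
  shows "integrable surface_measure f"
proof -
  have "compact (f ` sphere 0 1)" using assms by (intro compact_continuous_image) auto
  then obtain B where "\<forall>x\<in>sphere 0 1. norm (f x) \<le> B"
    using compact_imp_bounded[of "f ` sphere 0 1"] by (auto simp: bounded_iff)
  then show ?thesis
    using borel_measurable_surface_continuous_on[OF assms]
    by (intro surface.integrable_const_bound[of f B]) auto
qed

section \<open>Growth of power integrals\<close>

text \<open>Here \<open>m\<close> is to be the modulus of a peak function and \<open>V\<close> a
  superlevel set inside the cap. Off \<open>V\<close> the integrand is at most
  \<open>k\<^sub>0 powr t\<close>, so the integral over \<open>V\<close> is comparable to the whole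
  one uniformly in t, and the negated claim becomes a growth inequality for the whole integral
  alone. The solution x can be pushed past any \<open>X\<close>, since the iteration uses that
  inequality only from some exponent on.\<close>

lemma powr_integral_gap:
  fixes m :: "'x \<Rightarrow> real"
  assumes fin: "finite_measure M" and m [measurable]: "m \<in> borel_measurable M"
    and m01: "\<And>x. x \<in> space M \<Longrightarrow> 0 < m x \<and> m x \<le> 1"
    and ae: "AE x in M. m x < 1"
    and V [measurable]: "V \<in> sets M"
    and k0: "0 < k\<^sub>0" "k\<^sub>0 < 1" and off: "\<And>x. x \<in> space M - V \<Longrightarrow> m x \<le> k\<^sub>0"
    and pos: "\<And>k. k < 1 \<Longrightarrow> 0 < measure M {x \<in> space M. k < m x}"
    and p: "0 < p" "p < q" and L: "0 < L"
  shows "\<exists>x\<ge>X. L * (\<integral>z. m z powr (x * p) \<partial>M) powr (q / p) < (LINT z:V|M. m z powr (x * q))"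
proof (rule ccontr)
  interpret finite_measure M by fact
  define I where "I t = (\<integral>z. m z powr t \<partial>M)" for t
  define J where "J t = (LINT z:V|M. m z powr t)" for t
  define \<beta> where "\<beta> k = measure M {x \<in> space M. k < m x}" for k
  define \<theta> where "\<theta> = q / p"
  have \<theta>: "1 < \<theta>" using p by (simp add: \<theta>_def)
  have le1: "m x powr t \<le> 1" if "x \<in> space M" "0 \<le> t" for x t
    using m01[OF that(1)] that(2) by (simp add: powr_le1)
  have int: "integrable M (\<lambda>z. m z powr t)" if "0 \<le> t" for t
    by (rule integrable_const_bound[of _ 1]) (use le1[OF _ that] in \<open>auto\<close>)
  have intV: "integrable M (\<lambda>z. indicator V z * m z powr t)" if "0 \<le> t" for t
    using integrable_mult_indicator[OF V int[OF that]] by simp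
  have J_lower: "k powr t * \<beta> k \<le> J t" if "k\<^sub>0 \<le> k" "k < 1" "0 \<le> t" for k t
  proof -
    have "k powr t * \<beta> k = (\<integral>z. k powr t * indicator {x \<in> space M. k < m x} z \<partial>M)"
      by (simp add: \<beta>_def)
    also have "\<dots> \<le> J t"
      unfolding J_def set_lebesgue_integral_def real_scaleR_def
    proof (intro integral_mono)
      fix z assume z: "z \<in> space M"
      show "k powr t * indicator {x \<in> space M. k < m x} z \<le> indicator V z * m z powr t"
      proof (cases "k < m z")
        case True
        then have "z \<in> V" using off[of z] z that by force
        then show ?thesis using True z k0 that by (auto simp: indicator_def intro!: powr_mono2)
      qed (simp add: indicator_def)
    qed (use intV[OF that(3)] in \<open>auto simp: less_top[symmetric]\<close>)
    finally show ?thesis .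
  qed
  have J_le_I: "J t \<le> I t" if "0 \<le> t" for t
    unfolding J_def I_def set_lebesgue_integral_def real_scaleR_def
    using int[OF that] intV[OF that] by (intro integral_mono) (auto simp: indicator_def)
  have I_lower: "k powr t * \<beta> k \<le> I t" if "k\<^sub>0 \<le> k" "k < 1" "0 \<le> t" for k t
    using J_lower[OF that] J_le_I[OF that(3)] by simp
  have I_pos: "0 < I t" if "0 \<le> t" for t
  proof -
    have "0 < k\<^sub>0 powr t * \<beta> k\<^sub>0" using pos[OF k0(2)] k0 by (simp add: \<beta>_def)
    then show ?thesis using I_lower[of k\<^sub>0 t] that k0 by simp
  qed
  \<comment> \<open>\<open>J t\<close> is at least
    \<open>k\<^sub>0 powr t * \<beta> k\<^sub>0\<close>, so the part off \<open>V\<close> is at most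
    \<open>measure M (space M) / \<beta> k\<^sub>0\<close> times \<open>J t\<close>.\<close>
  define C where "C = 1 + measure M (space M) / \<beta> k\<^sub>0"
  have \<beta>0: "0 < \<beta> k\<^sub>0" using pos[OF k0(2)] by (simp add: \<beta>_def)
  then have C: "0 < C" by (simp add: C_def add_pos_nonneg)
  have I_le: "I t \<le> C * J t" if "0 \<le> t" for t
  proof -
    have "I t \<le> (\<integral>z. indicator V z * m z powr t + k\<^sub>0 powr t \<partial>M)"
      unfolding I_def
    proof (intro integral_mono)
      fix z assume z: "z \<in> space M"
      show "m z powr t \<le> indicator V z * m z powr t + k\<^sub>0 powr t"
        using off[of z] m01[OF z] z that by (auto simp: indicator_def intro!: powr_mono2)
    qed (use int[OF that] intV[OF that] in auto)
    also have "\<dots> = J t + k\<^sub>0 powr t * measure M (space M)"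
      unfolding J_def set_lebesgue_integral_def real_scaleR_def
      by (subst Bochner_Integration.integral_add) (use intV[OF that] in auto)
    also have "k\<^sub>0 powr t * measure M (space M) = (k\<^sub>0 powr t * \<beta> k\<^sub>0) * (measure M (space M) / \<beta> k\<^sub>0)"
      using \<beta>0 by simp
    also have "\<dots> \<le> J t * (measure M (space M) / \<beta> k\<^sub>0)"
      using J_lower[of k\<^sub>0 t] that k0 \<beta>0 by (intro mult_right_mono) auto
    finally show ?thesis by (simp add: C_def algebra_simps)
  qed
  assume "\<not> ?thesis"
  then have H: "J (x * q) \<le> L * I (x * p) powr \<theta>" if "X \<le> x" for x
    using that by (auto simp: J_def I_def \<theta>_def not_less)
  define D where "D = C * L"
  have D: "0 < D" using C L by (simp add: D_def)
  \<comment> \<open>With \<open>x = t / p\<close> the exponents \<open>x * p\<close> and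
    \<open>x * q\<close> of the negated claim become \<open>t\<close> and
    \<open>\<theta> * t\<close>.\<close>
  have step: "I (\<theta> * t) \<le> D * I t powr \<theta>" if "X * p \<le> t" "0 \<le> t" for t
  proof -
    have "I (\<theta> * t) \<le> C * J (\<theta> * t)" using that \<theta> by (intro I_le) auto
    also have "\<theta> * t = (t / p) * q" by (simp add: \<theta>_def)
    also have "C * J (t / p * q) \<le> C * (L * I (t / p * p) powr \<theta>)"
      using that p C by (intro mult_left_mono H) (auto simp: field_simps)
    finally show ?thesis using p by (simp add: D_def \<theta>_def mult_ac)
  qed
  \<comment> \<open>This factor absorbs \<open>D\<close>: \<open>E * I (\<theta> * t) \<le> (E * I t) powr \<theta>\<close>.\<close>
  define E where "E = D powr (1 / (\<theta> - 1))"
  have E: "0 < E" using D by (simp add: E_def)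
  have ED: "E * D = E powr \<theta>"
  proof -
    have "E powr (\<theta> - 1) = D" using \<theta> D by (simp add: E_def powr_powr)
    then show ?thesis using E by (simp add: powr_diff field_simps)
  qed
  \<comment> \<open>Dominated convergence, as \<open>m < 1\<close> almost everywhere: this supplies
    the starting exponent at which \<open>E * I\<close> is below 1.\<close>
  have "(\<lambda>n. \<integral>z. m z powr real n \<partial>M) \<longlonglongrightarrow> (\<integral>z. 0 \<partial>M)"
  proof (rule integral_dominated_convergence[where w = "\<lambda>_. 1"])
    show "AE z in M. (\<lambda>n. m z powr real n) \<longlonglongrightarrow> 0"
      using ae
    proof (rule AE_mp, intro AE_I2 impI)
      fix z assume "z \<in> space M" "m z < 1"
      then have "(\<lambda>n. m z ^ n) \<longlonglongrightarrow> 0" using m01[of z] by (intro LIMSEQ_power_zero) auto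
      then show "(\<lambda>n. m z powr real n) \<longlonglongrightarrow> 0"
        using m01[of z] \<open>z \<in> space M\<close> by (simp add: powr_realpow)
    qed
  qed (use le1 in auto)
  then have "(\<lambda>n. E * I (real n)) \<longlonglongrightarrow> 0" unfolding I_def by (auto intro: tendsto_mult_right_zero)
  then have "\<forall>\<^sub>F n in sequentially. E * I (real n) < 1"
    by (rule order_tendstoD) simp
  moreover have "\<forall>\<^sub>F n in sequentially. max 1 (X * p) \<le> real n"
    using filterlim_real_sequentially unfolding filterlim_at_top by blast
  ultimately have "\<forall>\<^sub>F n in sequentially. E * I (real n) < 1 \<and> max 1 (X * p) \<le> real n"
    by (rule eventually_conj)
  then obtain n where n: "E * I (real n) < 1" "max 1 (X * p) \<le> real n"
    using eventually_happens by force
  \<comment> \<open>\<open>T\<close> is at least \<open>X * p\<close>, so all exponents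
    \<open>\<theta> ^ k * T\<close> stay in the range of \<open>step\<close>.\<close>
  define T where "T = real n"
  have T: "E * I T < 1" "1 \<le> T" "X * p \<le> T" using n by (auto simp: T_def)
  define y where "y = E * I T"
  have y: "0 < y" "y < 1" using T E I_pos[of T] by (auto simp: y_def)
  have T_le: "T \<le> \<theta> ^ k * T" for k using T \<theta> by (simp add: one_le_power)
  have iter: "E * I (\<theta> ^ k * T) \<le> y powr (\<theta> ^ k)" for k
  proof (induction k)
    case 0 show ?case using y by (simp add: y_def)
  next
    case (Suc k)
    have "E * I (\<theta> ^ Suc k * T) \<le> E * (D * I (\<theta> ^ k * T) powr \<theta>)"
      using step[of "\<theta> ^ k * T"] T_le[of k] T E by (simp add: mult.assoc)
    also have "\<dots> = (E * I (\<theta> ^ k * T)) powr \<theta>"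
      using ED by (simp add: powr_mult mult.assoc[symmetric])
    also have "\<dots> \<le> (y powr (\<theta> ^ k)) powr \<theta>"
      using Suc.IH E \<theta> I_pos[of "\<theta> ^ k * T"] T_le[of k] T by (intro powr_mono2) auto
    also have "\<dots> = y powr (\<theta> ^ Suc k)" by (simp add: powr_powr mult.commute)
    finally show ?case .
  qed
  \<comment> \<open>\<open>k = z powr (1 / T)\<close> must satisfy \<open>k powr T > y\<close>,
    \<open>k < 1\<close> and \<open>k\<^sub>0 \<le> k\<close>; this forces z strictly between y and
    1 and at least \<open>k\<^sub>0 powr T\<close>. The lower bound for \<open>I\<close> then decays
    like z to the power \<open>\<theta> ^ i\<close>, the upper one like the smaller y to that
    power.\<close>
  define z where "z = max ((1 + y) / 2) (k\<^sub>0 powr T)"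
  have z: "y < z" "z < 1" "0 < z" "k\<^sub>0 powr T \<le> z"
  proof -
    have "k\<^sub>0 powr T < 1" using k0 T by (simp add: powr01_less_one)
    then show "z < 1" using y by (simp add: z_def)
    have "(1 + y) / 2 \<le> z" "k\<^sub>0 powr T \<le> z" by (simp_all add: z_def)
    then show "y < z" "0 < z" "k\<^sub>0 powr T \<le> z" using y by auto
  qed
  define k where "k = z powr (1 / T)"
  have k: "k\<^sub>0 \<le> k" "k < 1" "k powr T = z"
  proof -
    have "k\<^sub>0 = (k\<^sub>0 powr T) powr (1 / T)" using k0 T by (simp add: powr_powr)
    also have "\<dots> \<le> k" unfolding k_def using z T by (intro powr_mono2) auto
    finally show "k\<^sub>0 \<le> k" .
    show "k < 1" using z T by (simp add: k_def powr01_less_one)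
    show "k powr T = z" using z T by (simp add: k_def powr_powr)
  qed
  have upper: "E * \<beta> k \<le> (y / z) powr (\<theta> ^ i)" for i
  proof -
    have "E * (k powr (\<theta> ^ i * T) * \<beta> k) \<le> y powr (\<theta> ^ i)"
      using iter[of i] I_lower[of k "\<theta> ^ i * T"] k T T_le[of i] E
      by (smt (verit) mult_left_mono)
    moreover have "k powr (\<theta> ^ i * T) = z powr (\<theta> ^ i)"
      using k(3) by (metis mult.commute powr_powr)
    ultimately have "(E * \<beta> k) * z powr (\<theta> ^ i) \<le> y powr (\<theta> ^ i)" by (simp add: mult_ac)
    then show ?thesis using z y by (simp add: powr_divide field_simps)
  qed
  have "filterlim (\<lambda>i. \<theta> ^ i) at_top sequentially"
    using filterlim_realpow_sequentially_gt1[of \<theta>] \<theta>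
    by (auto simp: filterlim_at_infinity_conv_norm_at_top norm_power)
  then have "filterlim (\<lambda>i. ln (y / z) * \<theta> ^ i) at_bot sequentially"
    using y z by (intro filterlim_tendsto_neg_mult_at_bot[OF tendsto_const]) (auto simp: ln_div)
  then have "(\<lambda>i. exp (ln (y / z) * \<theta> ^ i)) \<longlonglongrightarrow> 0"
    by (rule filterlim_compose[OF exp_at_bot])
  then have "(\<lambda>i. (y / z) powr (\<theta> ^ i)) \<longlonglongrightarrow> 0"
    using y z by (simp add: powr_def mult.commute)
  then have "E * \<beta> k \<le> 0" using upper by (intro LIMSEQ_le_const[where X = "\<lambda>i. (y / z) powr (\<theta> ^ i)"]) auto
  moreover have "0 < E * \<beta> k" using E pos[OF k(2)] by (simp add: \<beta>_def)
  ultimately show False by simp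
qed

section \<open>Peak functions on the ball\<close>

lemma measure_superlevel_le_integral_powr:
  fixes m :: "'x \<Rightarrow> real"
  assumes "finite_measure M" and [measurable]: "m \<in> borel_measurable M"
    and int: "integrable M (\<lambda>z. m z powr t)" and "0 \<le> k" "0 \<le> t"
  shows "k powr t * measure M {x \<in> space M. k < m x} \<le> (\<integral>z. m z powr t \<partial>M)"
proof -
  interpret finite_measure M by fact
  have int': "integrable M (\<lambda>z. k powr t * indicator {x \<in> space M. k < m x} z)"
    by (intro integrable_mult_right integrable_real_indicator) (auto simp: less_top[symmetric])
  have "k powr t * measure M {x \<in> space M. k < m x}
      = (\<integral>z. k powr t * indicator {x \<in> space M. k < m x} z \<partial>M)"
    by simp
  also have "\<dots> \<le> (\<integral>z. m z powr t \<partial>M)"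
    using assms by (intro integral_mono int' int) (auto simp: indicator_def intro!: powr_mono2)
  finally show ?thesis .
qed

text \<open>The Hermitian product, with the conjugation in the second slot so that it is holomorphic
  in the first.\<close>

definition cip :: "complex ^ 'n \<Rightarrow> complex ^ 'n \<Rightarrow> complex" where
  "cip z w = (\<Sum>i\<in>UNIV. z $ i * cnj (w $ i))"

lemma cip_scaleR_left [simp]: "cip (r *\<^sub>R z) w = of_real r * cip z w"
  by (simp add: cip_def scaleR_sum_right flip: scaleR_conv_of_real)

lemma cip_diff_left: "cip (z - z') w = cip z w - cip z' w"
  by (simp add: cip_def left_diff_distrib sum_subtractf)

lemma Re_cip: "Re (cip z w) = z \<bullet> w"
  by (simp add: cip_def inner_vec_def inner_complex_def)

lemma norm_cip_le: "norm (cip z w) \<le> norm z * norm w"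
proof -
  have "norm (cip z w) \<le> (\<Sum>i\<in>UNIV. \<bar>norm (z $ i)\<bar> * \<bar>norm (w $ i)\<bar>)"
    unfolding cip_def by (rule order_trans[OF norm_sum]) (simp add: norm_mult)
  also have "\<dots> \<le> norm z * norm w"
    unfolding norm_vec_def by (rule L2_set_mult_ineq)
  finally show ?thesis .
qed

lemma cip_self: "cip z z = of_real ((norm z)\<^sup>2)"
proof (rule complex_eqI)
  show "Re (cip z z) = Re (of_real ((norm z)\<^sup>2))"
    by (simp only: Re_cip Re_complex_of_real power2_norm_eq_inner)
  show "Im (cip z z) = Im (of_real ((norm z)\<^sup>2))"
    by (simp add: cip_def)
qed

lemma has_derivative_cip:
  "((\<lambda>z. cip z w) has_derivative (\<lambda>h. cip h w)) (at z within S)"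
  unfolding cip_def by (intro has_derivative_sum has_derivative_mult_left bounded_linear_imp_has_derivative bounded_linear_vec_nth)

lemma continuous_on_cip [continuous_intros]:
  "continuous_on S f \<Longrightarrow> continuous_on S (\<lambda>z. cip (f z) w)"
  unfolding cip_def by (intro continuous_intros)

text \<open>Expanding the square and using that \<open>cip z \<zeta>\<close> has modulus at most 1
  leaves 2 + 2 Re \<open>cip z \<zeta>\<close>. So \<zeta> is the only peak, with a quantitative
  drop outside any cap around it.\<close>

lemma norm_one_plus_cip_le:
  assumes "norm z = 1" "norm \<zeta> = 1"
  shows "(norm (1 + cip z \<zeta>))\<^sup>2 \<le> 4 - (norm (z - \<zeta>))\<^sup>2"
proof -
  have "(norm (1 + cip z \<zeta>))\<^sup>2 = 1 + 2 * Re (cip z \<zeta>) + (norm (cip z \<zeta>))\<^sup>2"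
    by (simp add: cmod_power2) (simp add: power2_eq_square algebra_simps)
  also have "(norm (cip z \<zeta>))\<^sup>2 \<le> 1"
    using norm_cip_le[of z \<zeta>] assms by (simp add: power_le_one)
  also have "1 + 2 * Re (cip z \<zeta>) + 1 = 4 - (norm (z - \<zeta>))\<^sup>2"
    using assms by (simp add: Re_cip power2_norm_eq_inner inner_diff inner_commute norm_eq_1)
  finally show ?thesis by simp
qed

text \<open>The counterpart near \<zeta>: every superlevel set below the maximum contains a cap,
  hence has positive measure.\<close>

lemma norm_one_plus_cip_ge:
  assumes "norm \<zeta> = 1"
  shows "2 - norm (z - \<zeta>) \<le> norm (1 + cip z \<zeta>)"
proof -
  have "cip z \<zeta> - 1 = cip (z - \<zeta>) \<zeta>" using assms by (simp add: cip_diff_left cip_self)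
  then have "norm (cip z \<zeta> - 1) \<le> norm (z - \<zeta>)" using norm_cip_le[of "z - \<zeta>" \<zeta>] assms by simp
  then show ?thesis using norm_triangle_ineq2[of 2 "1 - cip z \<zeta>"] by (simp add: norm_minus_commute)
qed

lemma norm_vec_times_cnj: "norm (\<chi> i. c * cnj (w $ i)) = norm c * norm w"
  by (simp add: norm_vec_def norm_mult L2_set_right_distrib)

text \<open>The left side will bound the gradient of the peak function on a small ball, the right
  side its L^p norm from below.\<close>

lemma eventually_linear_times_powr_le:
  fixes a b c :: real
  assumes "0 < a" "a < b" "0 < c"
  shows "\<forall>\<^sub>F x in at_top. x * a powr (x - 1) \<le> c * b powr x"
proof -
  define l where "l = ln b - ln a"
  have l: "0 < l" using assms by (simp add: l_def)
  have "((\<lambda>x. (l * x) ^ 1 / exp (l * x)) \<longlongrightarrow> 0) at_top"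
    by (rule filterlim_compose[OF tendsto_power_div_exp_0])
      (use l in \<open>auto intro!: filterlim_tendsto_pos_mult_at_top[OF tendsto_const] filterlim_ident\<close>)
  moreover have "0 < c * a * l" using assms l by simp
  ultimately have "\<forall>\<^sub>F x in at_top. (l * x) ^ 1 / exp (l * x) < c * a * l"
    by (rule order_tendstoD)
  then show ?thesis
  proof eventually_elim
    case (elim x)
    have "x / exp (l * x) \<le> c * a" using elim l by (simp add: field_simps)
    moreover have "exp (l * x) = b powr x / a powr x"
      using assms by (simp add: l_def powr_def exp_diff right_diff_distrib mult.commute)
    ultimately have "x * a powr x \<le> c * a * b powr x"
      using assms by (simp add: field_simps)
    then show ?case using assms by (simp add: powr_diff field_simps)
  qed
qed

lemma sum_vec_times_cnj: "(\<Sum>i\<in>UNIV. (\<chi> i. c * cnj (w $ i)) $ i * h $ i) = c * cip h w"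
  by (simp add: cip_def sum_distrib_left mult_ac)

text \<open>One hump: as small as desired in L^p and, with its gradient \<open>a\<close>, on the
  ball of radius \<open>R\<close>, yet with a large L^q integral over the cap at some radius beyond
  \<open>R\<close>.\<close>

lemma cip_hump:
  fixes \<zeta> :: "complex ^ 'n"
  assumes \<zeta>: "norm \<zeta> = 1" and e: "0 < e" and p: "0 < p" "p < q" and \<delta>: "0 < \<delta>"
    and R: "0 \<le> R" "R < 1"
  obtains g :: "complex ^ 'n \<Rightarrow> complex" and a B r where "R < r" "r < 1"
    "\<And>z. z \<in> ball 0 1 \<Longrightarrow> (g has_derivative (\<lambda>h. \<Sum>i\<in>UNIV. a z $ i * h $ i)) (at z)"
    "\<And>z. z \<in> ball 0 1 \<Longrightarrow> norm (g z) \<le> B"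
    "\<And>z. z \<in> cball 0 R \<Longrightarrow> norm (g z) \<le> \<delta> \<and> norm (a z) \<le> \<delta>"
    "\<And>s. s \<in> {0<..<1} \<Longrightarrow> (\<integral>z. norm (g (s *\<^sub>R z)) powr p \<partial>surface_measure) \<le> \<delta> powr p"
    "L < (LINT z:sphere 0 1 \<inter> ball \<zeta> e|surface_measure. norm (g (r *\<^sub>R z)) powr q)"
proof -
  define u where "u z = norm (1 + cip z \<zeta>) / 2" for z
  \<comment> \<open>\<open>u\<close> vanishes at -\<zeta>, while the growth lemma asks for a
    positive function. The cut-off leaves the peak unchanged and also dominates the values of
    \<open>u\<close> along radii.\<close>
  define m where "m z = max (1 / 2) (u z)" for z
  \<comment> \<open>The first entry makes \<open>m\<close> and \<open>u\<close> agree on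
    \<open>V\<close>, the second puts \<open>V\<close> inside the cap by
    \<open>u_sq\<close>.\<close>
  define k\<^sub>0 where "k\<^sub>0 = max (1 / 2) (sqrt (1 - e\<^sup>2 / 4))"
  let ?S = "surface_measure :: (complex ^ 'n) measure"
  define V where "V = {z \<in> space ?S. k\<^sub>0 < m z}"
  have cont_u: "continuous_on S u" for S unfolding u_def by (intro continuous_intros) auto
  have cont_m: "continuous_on S m" for S unfolding m_def by (intro continuous_intros cont_u)
  have m_meas [measurable]: "m \<in> borel_measurable ?S"
    by (intro borel_measurable_surface_continuous_on cont_m)
  have u_le1: "u z \<le> 1" if "norm z \<le> 1" for z
    using norm_triangle_ineq[of 1 "cip z \<zeta>"] norm_cip_le[of z \<zeta>] that \<zeta> by (simp add: u_def)
  have u_sq: "(u z)\<^sup>2 \<le> 1 - (norm (z - \<zeta>))\<^sup>2 / 4" if "norm z = 1" for z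
    using norm_one_plus_cip_le[OF that \<zeta>] by (simp add: u_def power_divide)
  have m01: "0 < m z \<and> m z \<le> 1" if "norm z \<le> 1" for z
    using u_le1[OF that] by (auto simp: m_def)
  have k0: "0 < k\<^sub>0" "k\<^sub>0 < 1"
  proof -
    have "sqrt (1 - e\<^sup>2 / 4) < 1" using e by (auto intro: real_less_lsqrt)
    then show "0 < k\<^sub>0" "k\<^sub>0 < 1" by (auto simp: k\<^sub>0_def)
  qed
  have V_sub: "V \<subseteq> sphere 0 1 \<inter> ball \<zeta> e"
  proof
    fix z assume z: "z \<in> V"
    then have nz: "norm z = 1" by (simp add: V_def)
    have "norm (z - \<zeta>) < e"
    proof (rule ccontr)
      assume "\<not> ?thesis"
      then have "e\<^sup>2 \<le> (norm (z - \<zeta>))\<^sup>2" using e by (intro power_mono) auto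
      then have "(u z)\<^sup>2 \<le> 1 - e\<^sup>2 / 4" using u_sq[OF nz] by simp
      then have "u z \<le> sqrt (1 - e\<^sup>2 / 4)" by (rule real_le_rsqrt)
      then show False using z by (auto simp: V_def m_def k\<^sub>0_def)
    qed
    then show "z \<in> sphere 0 1 \<inter> ball \<zeta> e" using nz by (simp add: dist_norm norm_minus_commute)
  qed
  have V_u: "m z = u z" if "z \<in> V" for z
    using that by (auto simp: V_def m_def k\<^sub>0_def)
  have pos: "0 < measure ?S {z \<in> space ?S. k < m z}" if "k < 1" for k
  proof -
    have "0 < measure ?S (sphere 0 1 \<inter> ball \<zeta> (1 - k))"
      using that by (intro surface_measure_cap_pos \<zeta>) auto
    also have "\<dots> \<le> measure ?S {z \<in> space ?S. k < m z}"
    proof (intro surface.finite_measure_mono)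
      show "sphere 0 1 \<inter> ball \<zeta> (1 - k) \<subseteq> {z \<in> space ?S. k < m z}"
      proof
        fix z assume "z \<in> sphere 0 1 \<inter> ball \<zeta> (1 - k)"
        then have "norm z = 1" "norm (z - \<zeta>) < 1 - k" by (auto simp: dist_norm norm_minus_commute)
        moreover have "1 - norm (z - \<zeta>) / 2 \<le> u z"
          using norm_one_plus_cip_ge[OF \<zeta>, of z] by (simp add: u_def)
        moreover have "0 \<le> norm (z - \<zeta>)" by simp
        ultimately have "norm z = 1" "k < u z" by linarith+
        then show "z \<in> {z \<in> space ?S. k < m z}" by (simp add: m_def less_max_iff_disj)
      qed
    qed measurable
    finally show ?thesis .
  qed
  have ae: "AE z in ?S. m z < 1"
  proof (rule AE_I')
    have "2 * 1 \<le> DIM(complex) * CARD('n)" by (intro mult_mono) (auto simp: Suc_le_eq)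
    then show "{\<zeta>} \<in> null_sets ?S" by (intro surface_measure_singleton \<zeta>) (simp add: mult.commute)
    show "{z \<in> space ?S. \<not> m z < 1} \<subseteq> {\<zeta>}"
    proof
      fix z assume "z \<in> {z \<in> space ?S. \<not> m z < 1}"
      then have nz: "norm z = 1" and "1 \<le> m z" by auto
      then have "1 \<le> u z" by (auto simp: m_def)
      then have "1 \<le> (u z)\<^sup>2" by (simp add: one_le_power)
      then have "(norm (z - \<zeta>))\<^sup>2 \<le> 0" using u_sq[OF nz] by linarith
      then show "z \<in> {\<zeta>}" by simp
    qed
  qed
  \<comment> \<open>\<rho> bounds \<open>u\<close> on \<open>cball 0 R\<close>. Any \<open>k\<close>
    strictly between \<rho> and 1 serves, as \<open>k powr x\<close> eventually beats
    \<open>x * \<rho> powr (x - 1)\<close>.\<close>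
  define \<rho> where "\<rho> = (1 + R) / 2"
  define k where "k = (1 + \<rho>) / 2"
  have \<rho>: "0 < \<rho>" "\<rho> < k" "k < 1" "\<rho> < 1" using R by (auto simp: \<rho>_def k_def)
  define \<beta> where "\<beta> = measure ?S {z \<in> space ?S. k < m z}"
  have \<beta>: "0 < \<beta>" unfolding \<beta>_def by (rule pos) (rule \<rho>)
  \<comment> \<open>After scaling by \<open>A\<close> the L^q integral exceeds
    \<open>max L 1\<close>; the maximum only makes \<open>L'\<close> positive.\<close>
  define L' where "L' = max L 1 / \<delta> powr q"
  have L': "0 < L'" using \<delta> by (simp add: L'_def)
  have "\<forall>\<^sub>F x in at_top. x * \<rho> powr (x - 1) \<le> \<beta> powr (1 / p) * k powr x"
    using \<rho> \<beta> by (intro eventually_linear_times_powr_le) auto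
  then have "\<forall>\<^sub>F x in at_top. x * \<rho> powr (x - 1) \<le> \<beta> powr (1 / p) * k powr x \<and> 1 \<le> x"
    using eventually_ge_at_top[of "1::real"] by (rule eventually_conj)
  then obtain X where X: "\<And>x. X \<le> x \<Longrightarrow> x * \<rho> powr (x - 1) \<le> \<beta> powr (1 / p) * k powr x \<and> 1 \<le> x"
    by (auto simp: eventually_at_top_linorder)
  have "\<exists>x\<ge>X. L' * (\<integral>z. m z powr (x * p) \<partial>?S) powr (q / p) < (LINT z:V|?S. m z powr (x * q))"
  proof (rule powr_integral_gap[OF finite_measure_surface_measure m_meas _ ae _ k0 _ pos p L'])
    show "V \<in> sets ?S" unfolding V_def by measurable
    show "\<And>x. x \<in> space ?S - V \<Longrightarrow> m x \<le> k\<^sub>0" by (auto simp: V_def)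
  qed (use m01 in auto)
  then obtain x where xX: "X \<le> x"
    and gap: "L' * (\<integral>z. m z powr (x * p) \<partial>?S) powr (q / p) < (LINT z:V|?S. m z powr (x * q))"
    by blast
  have x: "1 \<le> x" "x * \<rho> powr (x - 1) \<le> \<beta> powr (1 / p) * k powr x" using X[OF xX] by auto
  define I where "I = (\<integral>z. m z powr (x * p) \<partial>?S)"
  have int_m: "integrable ?S (\<lambda>z. m z powr t)" for t
    by (intro integrable_surface_continuous_on continuous_intros cont_m) (use m01 in \<open>auto simp: less_le\<close>)
  have I_ge: "k powr (x * p) * \<beta> \<le> I"
    unfolding I_def \<beta>_def using \<rho> x p
    by (intro measure_superlevel_le_integral_powr finite_measure_surface_measure m_meas int_m) auto
  moreover have "0 < k powr (x * p) * \<beta>" using \<beta> \<rho> by simp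
  ultimately have I: "0 < I" by linarith
  have small: "x * \<rho> powr (x - 1) \<le> I powr (1 / p)"
  proof -
    have "\<beta> powr (1 / p) * k powr x = (k powr (x * p) * \<beta>) powr (1 / p)"
      using \<beta> \<rho> p by (simp add: powr_mult powr_powr)
    also have "\<dots> \<le> I powr (1 / p)" using I_ge \<beta> \<rho> p by (intro powr_mono2) auto
    finally show ?thesis using x by simp
  qed
  \<comment> \<open>Normalises \<open>A * m powr x\<close> to L^p norm exactly \<delta>.\<close>
  define A where "A = \<delta> / I powr (1 / p)"
  have A: "0 < A" using I \<delta> by (simp add: A_def)
  define g where "g z = of_real A * ((1 + cip z \<zeta>) / 2) powr of_real x" for z
  define a where "a z = (\<chi> i. (of_real A * (of_real x * ((1 + cip z \<zeta>) / 2) powr (of_real x - 1) / 2)) * cnj (\<zeta> $ i))" for z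
  have norm_g: "norm (g z) = A * u z powr x" for z
    using A by (simp add: g_def norm_mult norm_powr_real_powr' u_def norm_divide)
  have Re: "0 < Re ((1 + cip z \<zeta>) / 2)" if "norm z < 1" for z
    using abs_Re_le_cmod[of "cip z \<zeta>"] norm_cip_le[of z \<zeta>] that \<zeta> by simp
  have deriv: "(g has_derivative (\<lambda>h. \<Sum>i\<in>UNIV. a z $ i * h $ i)) (at z)" if "z \<in> ball 0 1" for z
  proof -
    have "(1 + cip z \<zeta>) / 2 \<notin> \<real>\<^sub>\<le>\<^sub>0" using Re[of z] that by (auto simp: complex_nonpos_Reals_iff)
    then have 1: "((\<lambda>w. of_real A * w powr of_real x) has_field_derivative
        of_real A * (of_real x * ((1 + cip z \<zeta>) / 2) powr (of_real x - 1))) (at ((1 + cip z \<zeta>) / 2))"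
      by (intro DERIV_cmult has_field_derivative_powr)
    have 2: "((\<lambda>z. (1 + cip z \<zeta>) / 2) has_derivative (\<lambda>h. cip h \<zeta> / 2)) (at z)"
      by (auto intro!: derivative_eq_intros has_derivative_cip)
    have "(g has_derivative (\<lambda>h. of_real A * (of_real x * ((1 + cip z \<zeta>) / 2) powr (of_real x - 1)) * (cip h \<zeta> / 2))) (at z)"
      using has_derivative_compose[OF 2 1[unfolded has_field_derivative_def]] unfolding g_def by simp
    moreover have "(\<Sum>i\<in>UNIV. a z $ i * h $ i)
        = of_real A * (of_real x * ((1 + cip z \<zeta>) / 2) powr (of_real x - 1)) * (cip h \<zeta> / 2)" for h
      unfolding a_def sum_vec_times_cnj by simp
    ultimately show ?thesis by (simp only:)
  qed
  have bound: "norm (g z) \<le> A" if "z \<in> ball 0 1" for z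
    using u_le1[of z] that A x by (auto simp: norm_g u_def intro!: mult_left_le powr_le1)
  have local: "norm (g z) \<le> \<delta> \<and> norm (a z) \<le> \<delta>" if "z \<in> cball 0 R" for z
  proof -
    have "norm (cip z \<zeta>) \<le> R" using norm_cip_le[of z \<zeta>] that \<zeta> by simp
    then have u\<rho>: "0 \<le> u z" "u z \<le> \<rho>" using norm_triangle_ineq[of 1 "cip z \<zeta>"] by (auto simp: u_def \<rho>_def)
    have A\<delta>: "A * (x * \<rho> powr (x - 1)) \<le> \<delta>"
      using mult_left_mono[OF small, of A] A I by (simp add: A_def)
    have "u z powr x \<le> \<rho> powr x" using u\<rho> x by (intro powr_mono2) auto
    also have "\<dots> = \<rho> * \<rho> powr (x - 1)" using \<rho> by (simp add: powr_mult_base)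
    also have "\<dots> \<le> x * \<rho> powr (x - 1)" using \<rho> x by (intro mult_right_mono) auto
    finally have "norm (g z) \<le> A * (x * \<rho> powr (x - 1))" using A by (simp add: norm_g)
    moreover have "norm (a z) \<le> A * (x * \<rho> powr (x - 1))"
    proof -
      have eq: "of_real x - 1 = complex_of_real (x - 1)" by simp
      have "norm (a z) = A * (x * u z powr (x - 1) / 2)"
        unfolding a_def norm_vec_times_cnj eq using A x \<zeta>
        by (simp add: norm_mult norm_divide norm_powr_real_powr' u_def del: of_real_diff)
      also have "\<dots> \<le> A * (x * \<rho> powr (x - 1) / 1)"
        using A x u\<rho> by (intro mult_left_mono frac_le powr_mono2) auto
      finally show ?thesis by simp
    qed
    ultimately show ?thesis using A\<delta> by linarith
  qed
  have hardy: "(\<integral>z. norm (g (s *\<^sub>R z)) powr p \<partial>?S) \<le> \<delta> powr p" if s: "s \<in> {0<..<1}" for s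
  proof -
    have "(\<integral>z. norm (g (s *\<^sub>R z)) powr p \<partial>?S) \<le> (\<integral>z. A powr p * m z powr (x * p) \<partial>?S)"
    proof (intro integral_mono')
      fix z assume "z \<in> space ?S"
      \<comment> \<open>1/2 is the value of \<open>u\<close> at the origin: the base at
        \<open>s *\<^sub>R z\<close> is a convex combination of its values at 0 and at
        \<open>z\<close>. So one boundary integral of \<open>m\<close> bounds all slices.\<close>
      have "norm (1 + cip (s *\<^sub>R z) \<zeta>) = norm (of_real (1 - s) + of_real s * (1 + cip z \<zeta>))"
        by (simp add: algebra_simps)
      also have "\<dots> \<le> (1 - s) * 1 + s * norm (1 + cip z \<zeta>)"
        by (rule norm_triangle_le) (use s in \<open>simp add: norm_mult del: of_real_diff\<close>)
      also have "\<dots> \<le> (1 - s) * (2 * m z) + s * (2 * m z)"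
        using s by (intro add_mono mult_left_mono) (auto simp: m_def u_def)
      finally have "u (s *\<^sub>R z) \<le> m z" by (simp add: u_def algebra_simps)
      then have "(A * u (s *\<^sub>R z) powr x) powr p \<le> (A * m z powr x) powr p"
        using A p x by (intro powr_mono2 mult_left_mono) (auto simp: u_def)
      then show "norm (g (s *\<^sub>R z)) powr p \<le> A powr p * m z powr (x * p)"
        using A by (simp add: norm_g powr_mult powr_powr)
    qed (use int_m in auto)
    also have "\<dots> = A powr p * I" by (simp add: I_def)
    also have "\<dots> = \<delta> powr p" using \<delta> I p by (simp add: A_def powr_divide powr_powr)
    finally show ?thesis .
  qed
  have u_meas [measurable]: "(\<lambda>z. u (s *\<^sub>R z)) \<in> borel_measurable ?S" for s
    unfolding u_def by (intro borel_measurable_surface_continuous_on continuous_intros) auto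
  have V_meas [measurable]: "V \<in> sets ?S" unfolding V_def by measurable
  have g_meas [measurable]: "(\<lambda>z. norm (g (s *\<^sub>R z)) powr q) \<in> borel_measurable ?S" for s
    unfolding norm_g by measurable
  have rn: "\<bar>1 - inverse (real (Suc n))\<bar> < 1" for n
  proof -
    have "0 < inverse (real (Suc n))" "inverse (real (Suc n)) \<le> 1" by (simp_all add: inverse_le_1_iff)
    then show ?thesis by linarith
  qed
  have g_le: "norm (g z) powr q \<le> A powr q" if "norm z < 1" for z
    using bound[of z] that p by (intro powr_mono2) auto
  \<comment> \<open>The growth lemma gives a large integral on the boundary sphere. The radii 1 -
    1/(n+1) carry it to the inside, past \<open>R\<close>; on \<open>V\<close> the base stays away
    from 0, so the powers converge.\<close>
  have "(\<lambda>n. \<integral>z. indicator V z * norm (g ((1 - inverse (real (Suc n))) *\<^sub>R z)) powr q \<partial>?S)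
      \<longlonglongrightarrow> (\<integral>z. indicator V z * norm (g z) powr q \<partial>?S)" (is "?J \<longlonglongrightarrow> ?K")
  proof (rule integral_dominated_convergence[where w = "\<lambda>_. A powr q"])
    show "(\<lambda>z. indicator V z * norm (g z) powr q) \<in> borel_measurable ?S"
      using g_meas[of 1] by simp
    have lim: "(\<lambda>n. 1 - inverse (real (Suc n))) \<longlonglongrightarrow> 1 - 0"
      by (intro tendsto_diff tendsto_const LIMSEQ_inverse_real_of_nat)
    show "AE z in ?S. (\<lambda>n. indicator V z * norm (g ((1 - inverse (real (Suc n))) *\<^sub>R z)) powr q)
        \<longlonglongrightarrow> indicator V z * norm (g z) powr q"
    proof (rule AE_I2)
      fix z
      show "(\<lambda>n. indicator V z * norm (g ((1 - inverse (real (Suc n))) *\<^sub>R z)) powr q)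
        \<longlonglongrightarrow> indicator V z * norm (g z) powr q"
      proof (cases "z \<in> V")
        case True
        then have uz: "u z \<noteq> 0" using V_u[OF True] by (auto simp: m_def max_def split: if_splits)
        have "(\<lambda>n. (1 - inverse (real (Suc n))) *\<^sub>R z) \<longlonglongrightarrow> (1 - 0) *\<^sub>R z"
          by (intro tendsto_scaleR lim tendsto_const)
        then have "(\<lambda>n. u ((1 - inverse (real (Suc n))) *\<^sub>R z)) \<longlonglongrightarrow> u z"
          using continuous_on_tendsto_compose[OF cont_u[of UNIV]] by simp
        then have "(\<lambda>n. (A * u ((1 - inverse (real (Suc n))) *\<^sub>R z) powr x) powr q) \<longlonglongrightarrow> (A * u z powr x) powr q"
          using uz A by (intro tendsto_intros) auto
        then show ?thesis unfolding norm_g by (intro tendsto_mult_left)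
      qed simp
    qed
    show "AE z in ?S. norm (indicator V z * norm (g ((1 - inverse (real (Suc n))) *\<^sub>R z)) powr q) \<le> A powr q" for n
    proof (rule AE_I2)
      fix z assume "z \<in> space ?S"
      then have "norm ((1 - inverse (real (Suc n))) *\<^sub>R z) < 1" using rn[of n] by simp
      from g_le[OF this]
      show "norm (indicator V z * norm (g ((1 - inverse (real (Suc n))) *\<^sub>R z)) powr q) \<le> A powr q"
        by (simp add: indicator_def)
    qed
  qed (use int_m in auto)
  moreover have "L < ?K"
  proof -
    have "?K = (\<integral>z. A powr q * (indicator V z * m z powr (x * q)) \<partial>?S)"
    proof (rule Bochner_Integration.integral_cong[OF refl])
      fix z show "indicator V z * norm (g z) powr q = A powr q * (indicator V z * m z powr (x * q))"
        using A V_u[of z] by (cases "z \<in> V") (simp_all add: norm_g powr_mult powr_powr)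
    qed
    also have "\<dots> = A powr q * (LINT z:V|?S. m z powr (x * q))"
      by (simp add: set_lebesgue_integral_def)
    also have "\<dots> > A powr q * (L' * I powr (q / p))"
      using gap A by (intro mult_strict_left_mono) (auto simp: I_def)
    also have "A powr q * (L' * I powr (q / p)) = max L 1"
      using I \<delta> by (simp add: A_def L'_def powr_divide powr_powr)
    finally show ?thesis by simp
  qed
  ultimately have "\<forall>\<^sub>F n in sequentially. L < ?J n" by (rule order_tendstoD)
  moreover have "(\<lambda>n. 1 - inverse (real (Suc n))) \<longlonglongrightarrow> 1 - 0"
    by (intro tendsto_diff tendsto_const LIMSEQ_inverse_real_of_nat)
  then have "\<forall>\<^sub>F n in sequentially. R < 1 - inverse (real (Suc n))" using R by (intro order_tendstoD) auto
  ultimately have "\<forall>\<^sub>F n in sequentially. L < ?J n \<and> R < 1 - inverse (real (Suc n))" by (rule eventually_conj)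
  then obtain n where n: "L < ?J n" "R < 1 - inverse (real (Suc n))"
    using eventually_happens by force
  define r where "r = 1 - inverse (real (Suc n))"
  show ?thesis
  proof
    show "R < r" "r < 1" using n by (auto simp: r_def)
    have "L < ?J n" by fact
    also have "?J n \<le> (LINT z:sphere 0 1 \<inter> ball \<zeta> e|?S. norm (g (r *\<^sub>R z)) powr q)"
      unfolding set_lebesgue_integral_def real_scaleR_def r_def
    proof (intro integral_mono')
      let ?r = "1 - inverse (real (Suc n))"
      have g_le': "norm (g (?r *\<^sub>R z)) powr q \<le> A powr q" if "z \<in> space ?S" for z
        using that rn[of n] by (intro g_le) simp
      show "integrable ?S (\<lambda>z. indicator (sphere 0 1 \<inter> ball \<zeta> e) z * norm (g (?r *\<^sub>R z)) powr q)"
      proof (rule surface.integrable_const_bound[of _ "A powr q"])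
        show "AE z in ?S. norm (indicator (sphere 0 1 \<inter> ball \<zeta> e) z * norm (g (?r *\<^sub>R z)) powr q) \<le> A powr q"
          using g_le' by (intro AE_I2) (auto simp: indicator_def)
        show "(\<lambda>z. indicator (sphere 0 1 \<inter> ball \<zeta> e) z * norm (g (?r *\<^sub>R z)) powr q) \<in> borel_measurable ?S"
          by (intro borel_measurable_times borel_measurable_indicator sets_surface_measure_cap g_meas) auto
      qed
      show "indicator V z * norm (g (?r *\<^sub>R z)) powr q
          \<le> indicator (sphere 0 1 \<inter> ball \<zeta> e) z * norm (g (?r *\<^sub>R z)) powr q" for z
        using V_sub by (intro mult_right_mono) (auto simp: indicator_def)
    qed (auto simp: indicator_def)
    finally show "L < (LINT z:sphere 0 1 \<inter> ball \<zeta> e|?S. norm (g (r *\<^sub>R z)) powr q)" .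
  qed (fact deriv bound local hardy)+
qed

section \<open>Slice integrals and Hardy norms\<close>

abbreviation slice_integral :: "real \<Rightarrow> (complex ^ 'n \<Rightarrow> complex) \<Rightarrow> real \<Rightarrow> real" where
  "slice_integral p f r \<equiv> \<integral>z. norm (f (r *\<^sub>R z)) powr p \<partial>surface_measure"

abbreviation cap_integral ::
  "real \<Rightarrow> (complex ^ 'n) set \<Rightarrow> (complex ^ 'n \<Rightarrow> complex) \<Rightarrow> real \<Rightarrow> real" where
  "cap_integral p A f r \<equiv> LINT z:sphere 0 1 \<inter> A|surface_measure. norm (f (r *\<^sub>R z)) powr p"

lemma continuous_on_slice:
  fixes f :: "'a::real_normed_vector \<Rightarrow> 'b::topological_space"
  assumes "continuous_on (ball 0 1) f" "r \<in> {0<..<1}"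
  shows "continuous_on (sphere 0 1) (\<lambda>z. f (r *\<^sub>R z))"
  using assms by (intro continuous_on_compose2[OF assms(1)] continuous_intros) auto

lemma integrable_slice:
  fixes f :: "complex ^ 'n \<Rightarrow> complex"
  assumes "continuous_on (ball 0 1) f" "r \<in> {0<..<1}" "0 < p"
  shows "integrable surface_measure (\<lambda>z. norm (f (r *\<^sub>R z)) powr p)"
  using assms by (intro integrable_surface_continuous_on continuous_on_powr' continuous_on_norm continuous_on_slice) auto

lemma integrable_cap:
  fixes f :: "complex ^ 'n \<Rightarrow> complex"
  assumes "continuous_on (ball 0 1) f" "r \<in> {0<..<1}" "0 < p" "A \<in> sets borel"
  shows "integrable surface_measure (\<lambda>z. indicator (sphere 0 1 \<inter> A) z * norm (f (r *\<^sub>R z)) powr p)"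
  using integrable_mult_indicator[OF sets_surface_measure_cap[OF assms(4)] integrable_slice[OF assms(1-3)]]
  by (simp only: real_scaleR_def)

lemma cap_integral_eq:
  "cap_integral p A f r = (\<integral>z. indicator (sphere 0 1 \<inter> A) z * norm (f (r *\<^sub>R z)) powr p \<partial>surface_measure)"
  by (simp only: set_lebesgue_integral_def real_scaleR_def)

lemma cap_integral_mono:
  assumes "continuous_on (ball 0 1) f" "r \<in> {0<..<1}" "0 < p" "A \<in> sets borel" "B \<in> sets borel" "A \<subseteq> B"
  shows "cap_integral p A f r \<le> cap_integral p B f r"
  unfolding cap_integral_eq using assms
  by (intro integral_mono integrable_cap mult_right_mono) (auto simp: indicator_def)

text \<open>A nonzero value persists by continuity on a cap of positive measure. This makes the
  metric separate points.\<close>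

lemma slice_integral_eq_0_imp:
  fixes f :: "complex ^ 'n \<Rightarrow> complex"
  assumes "continuous_on (ball 0 1) f" "r \<in> {0<..<1}" "0 < p" "slice_integral p f r = 0" "norm \<zeta> = 1"
  shows "f (r *\<^sub>R \<zeta>) = 0"
proof (rule ccontr)
  assume nz: "f (r *\<^sub>R \<zeta>) \<noteq> 0"
  define c where "c = norm (f (r *\<^sub>R \<zeta>)) / 2"
  have c: "0 < c" using nz by (simp add: c_def)
  have "\<exists>d>0. \<forall>z\<in>sphere 0 1. dist z \<zeta> < d \<longrightarrow> dist (f (r *\<^sub>R z)) (f (r *\<^sub>R \<zeta>)) < c"
    using continuous_on_slice[OF assms(1,2)] assms(5) c unfolding continuous_on_iff by auto
  then obtain d where d: "0 < d"
    and close: "\<And>z. norm z = 1 \<Longrightarrow> dist z \<zeta> < d \<Longrightarrow> dist (f (r *\<^sub>R z)) (f (r *\<^sub>R \<zeta>)) < c"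
    by auto
  have ge: "c \<le> norm (f (r *\<^sub>R z))" if "norm z = 1" "dist z \<zeta> < d" for z
    using close[OF that] norm_triangle_ineq2[of "f (r *\<^sub>R \<zeta>)" "f (r *\<^sub>R z)"]
    by (simp add: c_def dist_norm norm_minus_commute)
  have "0 < c powr p * measure surface_measure (sphere 0 1 \<inter> ball \<zeta> d)"
    using surface_measure_cap_pos[OF assms(5) d] c by simp
  also have "\<dots> = (\<integral>z. c powr p * indicator (sphere 0 1 \<inter> ball \<zeta> d) z \<partial>surface_measure)"
    by (simp add: Int_absorb2)
  also have "\<dots> \<le> slice_integral p f r"
  proof (intro integral_mono integrable_slice assms)
    show "integrable surface_measure (\<lambda>z. c powr p * indicator (sphere 0 1 \<inter> ball \<zeta> d) z)"
      by (intro integrable_mult_right integrable_real_indicator sets_surface_measure_cap)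
        (auto simp: less_top[symmetric])
    show "c powr p * indicator (sphere 0 1 \<inter> ball \<zeta> d) z \<le> norm (f (r *\<^sub>R z)) powr p"
      if "z \<in> space surface_measure" for z
      using ge[of z] c assms(3) that by (auto simp: indicator_def dist_commute intro!: powr_mono2)
  qed
  finally show False using assms(4) by simp
qed

text \<open>\<open>powr_interpolation_le\<close> with threshold \<open>c\<close>. The crude factor,
  total mass plus 1, is independent of \<open>f\<close>, \<open>r\<close> and the exponents.\<close>

lemma slice_integral_lower_exponent:
  fixes f :: "complex ^ 'n \<Rightarrow> complex"
  assumes "continuous_on (ball 0 1) f" "r \<in> {0<..<1}" "0 < s" "s \<le> p" "0 < c"
    and le: "slice_integral p f r \<le> c powr p"
  shows "slice_integral s f r \<le> c powr s * (measure surface_measure (sphere 0 (1::real) :: (complex ^ 'n) set) + 1)"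
proof -
  have "slice_integral s f r
      \<le> (\<integral>z. c powr s + c powr (s - p) * norm (f (r *\<^sub>R z)) powr p \<partial>surface_measure)"
    using assms by (intro integral_mono powr_interpolation_le integrable_slice
        Bochner_Integration.integrable_add integrable_mult_right) auto
  also have "\<dots> = c powr s * measure surface_measure (sphere 0 (1::real) :: (complex ^ 'n) set)
      + c powr (s - p) * slice_integral p f r"
    using integrable_slice[OF assms(1,2), of p] assms
    by (subst Bochner_Integration.integral_add) auto
  also have "c powr (s - p) * slice_integral p f r \<le> c powr (s - p) * c powr p"
    by (intro mult_left_mono le) auto
  also have "\<dots> = c powr s" by (simp flip: powr_add)
  finally show ?thesis by (simp add: algebra_simps)
qed

section \<open>Hardy norms as uniform bounds on slice integrals\<close>

lemma hardy_norm_le_iff: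
  assumes "0 < p" "0 \<le> c"
  shows "hardy_norm p f \<le> ennreal c \<longleftrightarrow> (\<forall>r\<in>{0<..<1}. slice_integral p f r \<le> c powr p)"
proof -
  have "slice_integral p f r powr (1 / p) \<le> c \<longleftrightarrow> slice_integral p f r \<le> c powr p" for r
  proof
    assume "slice_integral p f r powr (1 / p) \<le> c"
    then have "(slice_integral p f r powr (1 / p)) powr p \<le> c powr p"
      using assms by (intro powr_mono2) auto
    then show "slice_integral p f r \<le> c powr p" using assms by (simp add: powr_powr)
  next
    assume "slice_integral p f r \<le> c powr p"
    then have "slice_integral p f r powr (1 / p) \<le> (c powr p) powr (1 / p)"
      using assms by (intro powr_mono2) auto
    then show "slice_integral p f r powr (1 / p) \<le> c" using assms by (simp add: powr_powr)
  qed
  then show ?thesis using assms by (simp add: hardy_norm_def SUP_le_iff ennreal_le_iff)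
qed

lemma slice_integral_le_hardy_norm:
  assumes "hardy_norm p f < \<infinity>" "0 < p" "r \<in> {0<..<1}"
  shows "slice_integral p f r \<le> enn2real (hardy_norm p f) powr p"
  using hardy_norm_le_iff[of p "enn2real (hardy_norm p f)" f] assms by (auto simp: less_top)

lemma hardy_norm_leI:
  assumes "0 < p" "0 \<le> c" "\<And>r. r \<in> {0<..<1} \<Longrightarrow> slice_integral p f r \<le> c powr p"
  shows "hardy_norm p f < \<infinity>" "enn2real (hardy_norm p f) \<le> c"
proof -
  have le: "hardy_norm p f \<le> ennreal c" using assms by (subst hardy_norm_le_iff) auto
  then show "hardy_norm p f < \<infinity>" using ennreal_less_top[of c] by (simp add: order.strict_trans1)
  show "enn2real (hardy_norm p f) \<le> c"
    using enn2real_mono[OF le ennreal_less_top] assms by simp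
qed

lemma hardy_norm_add:
  assumes "1 \<le> p" "continuous_on (ball 0 1) f" "continuous_on (ball 0 1) g"
    "hardy_norm p f < \<infinity>" "hardy_norm p g < \<infinity>"
  shows "hardy_norm p (\<lambda>z. f z + g z) < \<infinity>"
    and "enn2real (hardy_norm p (\<lambda>z. f z + g z)) \<le> enn2real (hardy_norm p f) + enn2real (hardy_norm p g)"
proof -
  let ?a = "enn2real (hardy_norm p f)" and ?b = "enn2real (hardy_norm p g)"
  \<comment> \<open>The Minkowski lemma wants positive bounds, but a Hardy norm may be 0; the slack
    \<open>e\<close> is removed at the end.\<close>
  have le: "slice_integral p (\<lambda>z. f z + g z) r \<le> ((?a + e) + (?b + e)) powr p"
    if "0 < e" "r \<in> {0<..<1}" for e r
  proof (rule Minkowski_powr_le)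
    have "slice_integral p f r \<le> ?a powr p" "slice_integral p g r \<le> ?b powr p"
      using assms that by (intro slice_integral_le_hardy_norm; simp)+
    moreover have "?a powr p \<le> (?a + e) powr p" "?b powr p \<le> (?b + e) powr p"
      using assms that by (intro powr_mono2; simp)+
    ultimately show "slice_integral p f r \<le> (?a + e) powr p" "slice_integral p g r \<le> (?b + e) powr p"
      by linarith+
  qed (use assms that in \<open>auto intro!: integrable_slice borel_measurable_surface_continuous_on continuous_on_slice add_nonneg_pos\<close>)
  have *: "hardy_norm p (\<lambda>z. f z + g z) < \<infinity>" "enn2real (hardy_norm p (\<lambda>z. f z + g z)) \<le> (?a + e) + (?b + e)"
    if "0 < e" for e
  proof -
    have "0 < p" "0 \<le> (?a + e) + (?b + e)" using assms that by (auto intro!: add_nonneg_nonneg)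
    from hardy_norm_leI[OF this le[OF that]]
    show "hardy_norm p (\<lambda>z. f z + g z) < \<infinity>" "enn2real (hardy_norm p (\<lambda>z. f z + g z)) \<le> (?a + e) + (?b + e)"
      by blast+
  qed
  show "hardy_norm p (\<lambda>z. f z + g z) < \<infinity>" by (rule *(1)[of 1]) simp
  show "enn2real (hardy_norm p (\<lambda>z. f z + g z)) \<le> ?a + ?b"
  proof (rule field_le_epsilon)
    fix e :: real assume "0 < e"
    then show "enn2real (hardy_norm p (\<lambda>z. f z + g z)) \<le> ?a + ?b + e" using *(2)[of "e / 2"] by simp
  qed
qed

lemma hardy_norm_mult:
  assumes "0 < p" "hardy_norm p f < \<infinity>"
  shows "hardy_norm p (\<lambda>z. c * f z) < \<infinity>"
    and "enn2real (hardy_norm p (\<lambda>z. c * f z)) \<le> norm c * enn2real (hardy_norm p f)"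
proof -
  have "slice_integral p (\<lambda>z. c * f z) r \<le> (norm c * enn2real (hardy_norm p f)) powr p"
    if "r \<in> {0<..<1}" for r
  proof -
    have "slice_integral p (\<lambda>z. c * f z) r = norm c powr p * slice_integral p f r"
      by (simp add: norm_mult powr_mult)
    also have "\<dots> \<le> norm c powr p * enn2real (hardy_norm p f) powr p"
      using assms that by (intro mult_left_mono slice_integral_le_hardy_norm) auto
    finally show ?thesis by (simp add: powr_mult)
  qed
  from hardy_norm_leI[OF assms(1) mult_nonneg_nonneg[OF norm_ge_zero enn2real_nonneg] this]
  show "hardy_norm p (\<lambda>z. c * f z) < \<infinity>"
    "enn2real (hardy_norm p (\<lambda>z. c * f z)) \<le> norm c * enn2real (hardy_norm p f)"
    by blast+
qed

lemma hardy_norm_cong: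
  assumes "\<And>z. z \<in> ball 0 1 \<Longrightarrow> f z = g z"
  shows "hardy_norm p f = hardy_norm p g"
proof -
  have "slice_integral p f r = slice_integral p g r" if "r \<in> {0<..<1}" for r
    using that assms by (intro Bochner_Integration.integral_cong) auto
  then show ?thesis unfolding hardy_norm_def by (intro SUP_cong) auto
qed

lemma hardy_norm_eq_0_imp:
  fixes f :: "complex ^ 'n \<Rightarrow> complex"
  assumes "0 < p" "continuous_on (ball 0 1) f" "hardy_norm p f = 0" "z \<in> ball 0 1"
  shows "f z = 0"
proof -
  have *: "f (r *\<^sub>R \<zeta>) = 0" if r: "r \<in> {0<..<1}" and "norm \<zeta> = 1" for r \<zeta>
  proof (rule slice_integral_eq_0_imp[OF assms(2) r assms(1) _ that(2)])
    have "slice_integral p f r \<le> 0" using slice_integral_le_hardy_norm[of p f r] assms r by simp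
    then show "slice_integral p f r = 0" by (intro antisym) auto
  qed
  show ?thesis
  proof (cases "z = 0")
    case False
    then show ?thesis using *[of "norm z" "sgn z"] assms(4) by (simp add: norm_sgn) (simp add: sgn_div_norm)
  next
    case True
    obtain i where i: "i \<in> (Basis :: (complex ^ 'n) set)" using nonempty_Basis by blast
    \<comment> \<open>Slices have positive radius, so the origin is reached only as a limit. The
      double \<open>Suc\<close> keeps all radii below 1.\<close>
    let ?s = "\<lambda>n. inverse (real (Suc (Suc n)))"
    have "(\<lambda>n. ?s n *\<^sub>R i) \<longlonglongrightarrow> 0 *\<^sub>R i"
      by (intro tendsto_scaleR tendsto_const LIMSEQ_Suc[OF LIMSEQ_inverse_real_of_nat])
    moreover have "isCont f 0" using assms(2) by (simp add: continuous_on_eq_continuous_at)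
    ultimately have "(\<lambda>n. f (?s n *\<^sub>R i)) \<longlonglongrightarrow> f 0" by (auto intro: isCont_tendsto_compose)
    moreover have "f (?s n *\<^sub>R i) = 0" for n using i by (intro *) (auto simp: field_simps)
    ultimately show ?thesis using True LIMSEQ_unique[OF _ tendsto_const[of 0]] by simp
  qed
qed

section \<open>Membership in the global and local Hardy spaces\<close>

lemma holomorphic_on_ball_continuous:
  "f \<in> holomorphic_on_ball \<Longrightarrow> continuous_on (ball 0 1) f"
  unfolding holomorphic_on_ball_def holomorphic_several_def continuous_on_eq_continuous_within
  by (auto dest!: bspec intro: has_derivative_continuous)

lemma hardy_interD:
  assumes "f \<in> hardy_inter q" "1 < q"
  shows "f \<in> holomorphic_on_ball" "continuous_on (ball 0 1) f"
    and "\<And>p. 1 \<le> p \<Longrightarrow> p < q \<Longrightarrow> hardy_norm p f < \<infinity>"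
proof -
  show "f \<in> holomorphic_on_ball" using assms by (force simp: hardy_inter_def hardy_space_def)
  then show "continuous_on (ball 0 1) f" by (rule holomorphic_on_ball_continuous)
  show "\<And>p. 1 \<le> p \<Longrightarrow> p < q \<Longrightarrow> hardy_norm p f < \<infinity>"
    using assms by (force simp: hardy_inter_def hardy_space_def)
qed

lemma hardy_interI:
  assumes "f \<in> holomorphic_on_ball" "\<And>p. 1 \<le> p \<Longrightarrow> p < q \<Longrightarrow> hardy_norm p f < \<infinity>"
  shows "f \<in> hardy_inter q"
  using assms by (auto simp: hardy_inter_def hardy_space_def)

lemma hardy_norm_diff:
  assumes "f \<in> hardy_inter q" "g \<in> hardy_inter q" "1 \<le> p" "p < q"
  shows "hardy_norm p (\<lambda>z. f z - g z) < \<infinity>"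
proof -
  have q: "1 < q" using assms by simp
  note f = hardy_interD[OF assms(1) q] and g = hardy_interD[OF assms(2) q]
  have "hardy_norm p (\<lambda>z. f z + (- 1) * g z) < \<infinity>"
    using f(2,3) g(2,3) assms by (intro hardy_norm_add hardy_norm_mult continuous_intros) auto
  then show ?thesis by simp
qed

lemma local_hardy_space_iff:
  assumes "f \<in> holomorphic_on_ball"
  shows "f \<in> local_hardy_space q (sphere 0 1 \<inter> A) \<longleftrightarrow> (\<exists>M. \<forall>r\<in>{0<..<1}. cap_integral q A f r \<le> M)"
proof -
  have nonneg: "0 \<le> cap_integral q A f r" for r
    unfolding cap_integral_eq by (intro Bochner_Integration.integral_nonneg) auto
  have "(SUP r\<in>{0<..<1}. ennreal (cap_integral q A f r)) < \<infinity> \<longleftrightarrow> (\<exists>M. \<forall>r\<in>{0<..<1}. cap_integral q A f r \<le> M)"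
  proof
    assume "(SUP r\<in>{0<..<1}. ennreal (cap_integral q A f r)) < \<infinity>"
    then have "\<exists>M\<ge>0. (SUP r\<in>{0<..<1}. ennreal (cap_integral q A f r)) = ennreal M"
      unfolding infinity_ennreal_def less_top_ennreal by blast
    then obtain M where "0 \<le> M" and M: "(SUP r\<in>{0<..<1}. ennreal (cap_integral q A f r)) = ennreal M"
      by blast
    have "\<forall>r\<in>{0<..<1}. ennreal (cap_integral q A f r) \<le> ennreal M"
      unfolding M[symmetric] by (intro ballI SUP_upper)
    then show "\<exists>M. \<forall>r\<in>{0<..<1}. cap_integral q A f r \<le> M" using \<open>0 \<le> M\<close> by (auto simp: ennreal_le_iff)
  next
    assume "\<exists>M. \<forall>r\<in>{0<..<1}. cap_integral q A f r \<le> M"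
    then obtain M where "\<forall>r\<in>{0<..<1}. cap_integral q A f r \<le> M" by blast
    then have "(SUP r\<in>{0<..<1}. ennreal (cap_integral q A f r)) \<le> ennreal M"
      by (intro SUP_least ennreal_leI) auto
    then show "(SUP r\<in>{0<..<1}. ennreal (cap_integral q A f r)) < \<infinity>"
      using ennreal_less_top[of M] by (simp add: order.strict_trans1)
  qed
  then show ?thesis using assms by (simp add: local_hardy_space_def)
qed

section \<open>A function with locally infinite Hardy norms\<close>

text \<open>The last bound anticipates the use of the sum h: at radius \<open>r (Suc n)\<close> the
  earlier humps amount to at most \<open>B n\<close> and the later ones to at most 1, so |g_(n+1)|^q
  is at most 2^q (|h|^q + (B n + 1)^q). What remains for h over the n-th cap then exceeds n.\<close>

lemma hump_sequence:
  fixes c :: "nat \<Rightarrow> complex ^ 'n" and e :: "nat \<Rightarrow> real"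
  assumes c: "\<And>k. norm (c k) = 1" and e: "\<And>k. 0 < e k" and q: "1 < q"
  obtains g :: "nat \<Rightarrow> complex ^ 'n \<Rightarrow> complex" and a B r where
    "\<And>n. 0 < r n \<and> r n < 1" "\<And>n. 1 - 1 / (real n + 1) \<le> r n" "\<And>n. r n \<le> r (Suc n)"
    "\<And>n z. z \<in> ball 0 1 \<Longrightarrow> (g n has_derivative (\<lambda>h. \<Sum>i\<in>UNIV. a n z $ i * h $ i)) (at z)"
    "\<And>n. 0 \<le> B n" "\<And>n z. z \<in> ball 0 1 \<Longrightarrow> (\<Sum>l\<le>n. norm (g l z)) \<le> B n"
    "\<And>n z. z \<in> cball 0 (r n) \<Longrightarrow> norm (g (Suc n) z) \<le> (1 / 2) ^ Suc n \<and> norm (a (Suc n) z) \<le> (1 / 2) ^ Suc n"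
    "\<And>n s. s \<in> {0<..<1} \<Longrightarrow>
       slice_integral (q - (q - 1) / (real n + 2)) (g n) s \<le> ((1 / 2) ^ n) powr (q - (q - 1) / (real n + 2))"
    "\<And>n. 2 powr q * (real n + (B n + 1) powr q * measure surface_measure (sphere 0 1 :: (complex ^ 'n) set))
       < cap_integral q (ball (c n) (e n)) (g (Suc n)) (r (Suc n))"
proof -
  \<comment> \<open>Any sequence below q with limit q would serve; this one starts at the midpoint
    of 1 and q.\<close>
  define p where "p n = q - (q - 1) / (real n + 2)" for n :: nat
  have p: "0 < p n" "p n < q" for n
  proof -
    have "(q - 1) / (real n + 2) \<le> (q - 1) / 1" using q by (intro divide_left_mono) auto
    then show "0 < p n" by (simp add: p_def)
    show "p n < q" using q by (simp add: p_def)
  qed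
  \<comment> \<open>A state \<open>(g, a, B, r)\<close> holds the current hump, its gradient, a bound for the sum of all humps so far
    and the radius at which the hump is large; the next hump is negligible up to this radius.\<close>
  define P where "P n x \<longleftrightarrow> (case x of (g, a, B, r) \<Rightarrow>
      0 < r \<and> r < 1 \<and> 1 - 1 / (real n + 1) \<le> r \<and>
      (\<forall>z\<in>ball 0 1. (g has_derivative (\<lambda>h. \<Sum>i\<in>UNIV. a z $ i * h $ i)) (at z)) \<and>
      0 \<le> B \<and> (\<forall>z\<in>ball 0 1. norm (g z) \<le> B) \<and>
      (\<forall>s\<in>{0<..<1}. slice_integral (p n) g s \<le> ((1 / 2) ^ n) powr p n))"
    for n and x :: "(complex ^ 'n \<Rightarrow> complex) \<times> (complex ^ 'n \<Rightarrow> complex ^ 'n) \<times> real \<times> real"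
  define Q where "Q n x y \<longleftrightarrow> (case x of (g, a, B, r) \<Rightarrow> case y of (g', a', B', r') \<Rightarrow>
      r \<le> r' \<and> (\<forall>z\<in>ball 0 1. B + norm (g' z) \<le> B') \<and>
      (\<forall>z\<in>cball 0 r. norm (g' z) \<le> (1 / 2) ^ Suc n \<and> norm (a' z) \<le> (1 / 2) ^ Suc n) \<and>
      2 powr q * (real n + (B + 1) powr q * measure surface_measure (sphere 0 1 :: (complex ^ 'n) set))
       < cap_integral q (ball (c n) (e n)) g' r')"
    for n :: nat and x y :: "(complex ^ 'n \<Rightarrow> complex) \<times> (complex ^ 'n \<Rightarrow> complex ^ 'n) \<times> real \<times> real"
  have "\<exists>f. \<forall>n. P n (f n) \<and> Q n (f n) (f (Suc n))"
  proof (rule dependent_nat_choice)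
    \<comment> \<open>Hump 0 is zero, so the hump for the n-th cap is the one with index
      \<open>Suc n\<close>.\<close>
    have "P 0 ((\<lambda>_. 0), (\<lambda>_. 0), 0, 1 / 2)" using p[of 0] by (simp add: P_def)
    then show "\<exists>x. P 0 x" by blast
  next
    fix x n assume "P n x"
    obtain g a B r where x: "x = (g, a, B, r)" by (cases x)
    have r: "0 < r" "r < 1" and B: "0 \<le> B" using \<open>P n x\<close> by (auto simp: x P_def)
    \<comment> \<open>The second entry drives the radii to 1, so that every point of the ball is
      eventually in the region where new humps are negligible.\<close>
    define R where "R = max r (1 - 1 / (real (Suc n) + 1))"
    have R: "0 \<le> R" "R < 1" "r \<le> R" "1 - 1 / (real (Suc n) + 1) \<le> R" using r by (auto simp: R_def)
    have half: "0 < (1 / 2 :: real) ^ Suc n" by simp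
    obtain g' :: "complex ^ 'n \<Rightarrow> complex" and a' C r' where *: "R < r'" "r' < 1"
      "\<And>z. z \<in> ball 0 1 \<Longrightarrow> (g' has_derivative (\<lambda>h. \<Sum>i\<in>UNIV. a' z $ i * h $ i)) (at z)"
      "\<And>z. z \<in> ball 0 1 \<Longrightarrow> norm (g' z) \<le> C"
      "\<And>z. z \<in> cball 0 R \<Longrightarrow> norm (g' z) \<le> (1 / 2) ^ Suc n \<and> norm (a' z) \<le> (1 / 2) ^ Suc n"
      "\<And>s. s \<in> {0<..<1} \<Longrightarrow> slice_integral (p (Suc n)) g' s \<le> ((1 / 2) ^ Suc n) powr p (Suc n)"
      "2 powr q * (real n + (B + 1) powr q * measure surface_measure (sphere 0 1 :: (complex ^ 'n) set))
        < cap_integral q (ball (c n) (e n)) g' r'"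
      by (rule cip_hump[OF c[of n] e[of n] p(1)[of "Suc n"] p(2)[of "Suc n"] half R(1,2)]) blast
    have C: "0 \<le> C" using *(4)[of 0] norm_ge_zero[of "g' 0"] by (simp del: norm_ge_zero)
    have "P (Suc n) (g', a', B + C, r')"
      unfolding P_def prod.case using *(1-4,6) R r B C by (auto intro: order_trans add_increasing)
    moreover have "Q n x (g', a', B + C, r')"
      unfolding Q_def prod.case x using *(1,4,5,7) R by auto
    ultimately show "\<exists>y. P (Suc n) y \<and> Q n x y" by blast
  qed
  then obtain f where f: "\<And>n. P n (f n)" "\<And>n. Q n (f n) (f (Suc n))" by blast
  define g where "g n = fst (f n)" for n
  define a where "a n = fst (snd (f n))" for n
  define B where "B n = fst (snd (snd (f n)))" for n
  define r where "r n = snd (snd (snd (f n)))" for n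
  have f_eq: "f n = (g n, a n, B n, r n)" for n by (simp add: g_def a_def B_def r_def)
  note PP = f(1)[unfolded f_eq P_def prod.case] and QQ = f(2)[unfolded f_eq Q_def prod.case]
  note P_r = PP[THEN conjunct1] PP[THEN conjunct2, THEN conjunct1]
    PP[THEN conjunct2, THEN conjunct2, THEN conjunct1]
  note PP' = PP[THEN conjunct2, THEN conjunct2, THEN conjunct2]
  note P_rest = PP'[THEN conjunct1] PP'[THEN conjunct2, THEN conjunct1]
    PP'[THEN conjunct2, THEN conjunct2, THEN conjunct1] PP'[THEN conjunct2, THEN conjunct2, THEN conjunct2]
  note Q_rest = QQ[THEN conjunct1] QQ[THEN conjunct2, THEN conjunct1]
    QQ[THEN conjunct2, THEN conjunct2, THEN conjunct1] QQ[THEN conjunct2, THEN conjunct2, THEN conjunct2]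
  show ?thesis
  proof (rule that)
    show "0 < r n \<and> r n < 1" for n by (intro conjI P_r)
    show "1 - 1 / (real n + 1) \<le> r n" for n by (rule P_r(3))
    show "r n \<le> r (Suc n)" for n by (rule Q_rest(1))
    show "(g n has_derivative (\<lambda>h. \<Sum>i\<in>UNIV. a n z $ i * h $ i)) (at z)" if "z \<in> ball 0 1" for n z
      using P_rest(1) that by (rule bspec)
    show "0 \<le> B n" for n by (rule P_rest(2))
    show "(\<Sum>l\<le>n. norm (g l z)) \<le> B n" if z: "z \<in> ball 0 1" for n z
    proof (induction n)
      case 0 then show ?case using bspec[OF P_rest(3)[of 0] z] by simp
    next
      case (Suc n)
      then show ?case using bspec[OF Q_rest(2)[of n] z] by simp
    qed
    show "norm (g (Suc n) z) \<le> (1 / 2) ^ Suc n \<and> norm (a (Suc n) z) \<le> (1 / 2) ^ Suc n" if "z \<in> cball 0 (r n)" for n z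
      using Q_rest(3) that by (rule bspec)
    show "slice_integral (q - (q - 1) / (real n + 2)) (g n) s \<le> ((1 / 2) ^ n) powr (q - (q - 1) / (real n + 2))"
      if "s \<in> {0<..<1}" for n s
      using P_rest(4)[of n] that unfolding p_def by (rule bspec)
  qed (rule Q_rest(4))
qed

text \<open>Stated in a Banach space because it serves both the humps and their gradient
  vectors.\<close>

lemma geometric_tail:
  fixes b :: "nat \<Rightarrow> 'a::banach"
  assumes le: "\<And>l. m \<le> l \<Longrightarrow> norm (b l) \<le> (1 / 2) ^ l"
  shows "summable b" "norm (suminf b - sum b {..<m}) \<le> 2 * (1 / 2) ^ m"
proof -
  show sb: "summable b"
    by (rule summable_comparison_test'[of "\<lambda>l. (1 / 2) ^ l" m]) (use le in auto)
  have geo: "(\<lambda>l. (1 / 2 :: real) ^ (l + m)) sums (2 * (1 / 2) ^ m)"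
    using sums_mult2[OF geometric_sums[of "1 / 2 :: real"], of "(1 / 2) ^ m"] by (simp add: power_add)
  have "suminf b - sum b {..<m} = (\<Sum>l. b (l + m))" using suminf_minus_initial_segment[OF sb] by simp
  also have "norm \<dots> \<le> (\<Sum>l. (1 / 2) ^ (l + m))"
    by (rule norm_suminf_le) (use le geo in \<open>auto intro: sums_summable\<close>)
  also have "\<dots> = 2 * (1 / 2) ^ m" using geo by (simp add: sums_iff)
  finally show "norm (suminf b - sum b {..<m}) \<le> 2 * (1 / 2) ^ m" .
qed

lemma norm_sum_nth_mult_le:
  fixes v h :: "complex ^ 'n"
  shows "norm (\<Sum>i\<in>UNIV. v $ i * h $ i) \<le> norm v * norm h"
proof -
  have "norm (\<Sum>i\<in>UNIV. v $ i * h $ i) \<le> (\<Sum>i\<in>UNIV. \<bar>norm (v $ i)\<bar> * \<bar>norm (h $ i)\<bar>)"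
    by (rule order_trans[OF norm_sum]) (simp add: norm_mult)
  also have "\<dots> \<le> norm v * norm h"
    unfolding norm_vec_def by (rule L2_set_mult_ineq)
  finally show ?thesis .
qed

text \<open>Termwise real differentiation. Each derivative is given by a gradient vector, so the
  limit derivative is given by the sum of these vectors and stays complex-linear; their geometric
  decay gives the uniform convergence. Hence the humps carry gradient bounds as well.\<close>

lemma holomorphic_several_suminf:
  fixes g :: "nat \<Rightarrow> complex ^ 'n \<Rightarrow> complex"
  assumes deriv: "\<And>l z. z \<in> ball 0 1 \<Longrightarrow> (g l has_derivative (\<lambda>h. \<Sum>i\<in>UNIV. a l z $ i * h $ i)) (at z)"
    and small: "\<And>z :: complex ^ 'n. z \<in> ball 0 1 \<Longrightarrow> \<exists>s m. norm z < s \<and> s \<le> 1 \<and>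
      (\<forall>w\<in>ball 0 s. \<forall>l\<ge>m. norm (g l w) \<le> (1 / 2) ^ l \<and> norm (a l w) \<le> (1 / 2) ^ l)"
  shows "holomorphic_several (\<lambda>z. \<Sum>l. g l z) (ball 0 1)"
  unfolding holomorphic_several_def
proof
  fix z :: "complex ^ 'n" assume "z \<in> ball 0 1"
  from small[OF this] obtain s m where s: "norm z < s" "s \<le> 1"
    and le: "\<And>w l. w \<in> ball 0 s \<Longrightarrow> m \<le> l \<Longrightarrow> norm (g l w) \<le> (1 / 2) ^ l \<and> norm (a l w) \<le> (1 / 2) ^ l"
    by blast
  define f' where "f' l w = (\<lambda>h. \<Sum>i\<in>UNIV. a l w $ i * h $ i)" for l w
  define v where "v w = (\<Sum>l. a l w)" for w
  define g' where "g' w = (\<lambda>h. \<Sum>i\<in>UNIV. v w $ i * h $ i)" for w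
  have "\<exists>G. \<forall>w\<in>ball 0 s. (\<lambda>l. g l w) sums G w \<and> (G has_derivative g' w) (at w within ball 0 s)"
  proof (rule has_derivative_series[of "ball 0 s" g f' g' z])
    show "(g l has_derivative f' l w) (at w within ball 0 s)" if "w \<in> ball 0 s" for l w
      unfolding f'_def by (rule has_derivative_at_withinI, rule deriv) (use that s in auto)
    fix \<epsilon> :: real assume "0 < \<epsilon>"
    have "(\<lambda>n. 2 * (1 / 2 :: real) ^ n) \<longlonglongrightarrow> 2 * 0" by (intro tendsto_mult tendsto_const LIMSEQ_power_zero) auto
    then have "\<forall>\<^sub>F n in sequentially. 2 * (1 / 2 :: real) ^ n < \<epsilon>" using \<open>0 < \<epsilon>\<close> by (intro order_tendstoD) auto
    then show "\<forall>\<^sub>F n in sequentially. \<forall>w\<in>ball 0 s. \<forall>h.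
        norm ((\<Sum>l<n. f' l w h) - g' w h) \<le> \<epsilon> * norm h"
      using eventually_ge_at_top[of m]
    proof eventually_elim
      case (elim n)
      show ?case
      proof (intro ballI allI)
        fix w h :: "complex ^ 'n" assume w: "w \<in> ball 0 s"
        have "(\<Sum>l<n. f' l w h) - g' w h
            = (\<Sum>i\<in>UNIV. (- (v w - (\<Sum>l<n. a l w))) $ i * h $ i)"
          unfolding f'_def g'_def by (subst sum.swap) (simp add: sum_subtractf left_diff_distrib sum_distrib_right)
        also have "norm \<dots> \<le> norm (v w - (\<Sum>l<n. a l w)) * norm h"
          using norm_sum_nth_mult_le[of "- (v w - (\<Sum>l<n. a l w))" h] by (simp only: norm_minus_cancel)
        also have "\<dots> \<le> 2 * (1 / 2) ^ n * norm h"
          unfolding v_def using le[OF w] elim(2) by (intro mult_right_mono geometric_tail) auto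
        also have "\<dots> \<le> \<epsilon> * norm h" using elim(1) by (intro mult_right_mono) auto
        finally show "norm ((\<Sum>l<n. f' l w h) - g' w h) \<le> \<epsilon> * norm h" .
      qed
    qed
  next
    show "z \<in> ball 0 s" using s by simp
    then have "summable (\<lambda>l. g l z)" using le by (intro geometric_tail(1)[of m]) auto
    then show "(\<lambda>l. g l z) sums (\<Sum>l. g l z)" by (rule summable_sums)
  qed simp
  then obtain G where G': "\<forall>w\<in>ball 0 s. (\<lambda>l. g l w) sums G w \<and> (G has_derivative g' w) (at w within ball 0 s)"
    by (rule exE)
  have zs: "z \<in> ball 0 s" using s by simp
  have G: "(\<lambda>l. g l w) sums G w" if "w \<in> ball 0 s" for w using bspec[OF G' that] by (rule conjunct1)
  have G2: "(G has_derivative g' z) (at z within ball 0 s)" using bspec[OF G' zs] by (rule conjunct2)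
  have "(G has_derivative g' z) (at z)"
    using G2 zs by (subst (asm) at_within_open) auto
  then have "((\<lambda>z. \<Sum>l. g l z) has_derivative g' z) (at z)"
    by (rule has_derivative_transform_within_open[where s = "ball 0 s"]) (use G zs in \<open>auto simp: sums_iff\<close>)
  then show "\<exists>v. ((\<lambda>z. \<Sum>l. g l z) has_derivative (\<lambda>h. \<Sum>i\<in>UNIV. v $ i * h $ i)) (at z within ball 0 1)"
    unfolding g'_def by (blast intro: has_derivative_at_withinI)
qed

text \<open>Local Hardy membership passes to smaller caps, so it is enough that every ball around a
  point of the sphere contains some listed ball.\<close>

lemma countable_cap_base:
  obtains c :: "nat \<Rightarrow> 'a::euclidean_space" and e :: "nat \<Rightarrow> real"
  where "\<And>k. norm (c k) = 1" "\<And>k. 0 < e k"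
    "\<And>\<zeta> \<epsilon>. norm \<zeta> = 1 \<Longrightarrow> 0 < \<epsilon> \<Longrightarrow> \<exists>k. ball (c k) (e k) \<subseteq> ball \<zeta> \<epsilon>"
proof -
  obtain T :: "'a set" where T: "countable T" "T \<subseteq> sphere 0 1" "sphere 0 1 \<subseteq> closure T"
    by (rule separable[of "sphere 0 1 :: 'a set"])
  have "T \<noteq> {}"
  proof
    assume "T = {}"
    then have "sphere (0::'a) 1 = {}" using T(3) by simp
    then show False by simp
  qed
  \<comment> \<open>One index codes a point of the dense set and a radius 1/(n+1).\<close>
  define c where "c k = from_nat_into T (fst (prod_decode k))" for k
  define e where "e k = 1 / real (Suc (snd (prod_decode k)))" for k
  show ?thesis
  proof
    show "norm (c k) = 1" for k using from_nat_into[OF \<open>T \<noteq> {}\<close>] T(2) by (force simp: c_def)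
    show "0 < e k" for k by (simp add: e_def)
    fix \<zeta> :: 'a and \<epsilon> :: real assume "norm \<zeta> = 1" and \<epsilon>: "0 < \<epsilon>"
    then have "\<zeta> \<in> closure T" using T(3) by auto
    obtain n where n: "1 / real (Suc n) < \<epsilon> / 2" using nat_approx_posE[of "\<epsilon> / 2"] \<epsilon> by auto
    obtain y where y: "y \<in> T" "dist y \<zeta> < \<epsilon> / 2"
      using \<open>\<zeta> \<in> closure T\<close> \<epsilon> unfolding closure_approachable by (metis half_gt_zero)
    define k where "k = prod_encode (to_nat_on T y, n)"
    have "c k = y" using T(1) y(1) by (simp add: c_def k_def)
    moreover have "e k = 1 / real (Suc n)" by (simp add: e_def k_def)
    moreover have "ball y (1 / real (Suc n)) \<subseteq> ball \<zeta> \<epsilon>"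
    proof
      fix x assume "x \<in> ball y (1 / real (Suc n))"
      then have "dist y x < 1 / real (Suc n)" by (simp only: mem_ball)
      then have "dist \<zeta> x < \<epsilon>" using dist_triangle3[of \<zeta> x y] y(2) n by linarith
      then show "x \<in> ball \<zeta> \<epsilon>" by (simp only: mem_ball)
    qed
    ultimately have "ball (c k) (e k) \<subseteq> ball \<zeta> \<epsilon>" by (simp only:)
    then show "\<exists>k. ball (c k) (e k) \<subseteq> ball \<zeta> \<epsilon>" by blast
  qed
qed

section \<open>Linear combinations and finite sums\<close>

lemma holomorphic_several_restrict:
  assumes "holomorphic_several f (ball 0 1)"
  shows "restrict f (ball 0 1) \<in> holomorphic_on_ball"
  using assms unfolding holomorphic_on_ball_def holomorphic_several_def
  by (auto intro!: has_derivative_transform[of _ "ball 0 1" "restrict f (ball 0 1)" f] dest!: bspec)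

lemma holomorphic_on_ball_add_mult:
  fixes f g :: "complex ^ 'n \<Rightarrow> complex"
  assumes "f \<in> holomorphic_on_ball" "g \<in> holomorphic_on_ball"
  shows "(\<lambda>z\<in>ball 0 1. f z + t * g z) \<in> holomorphic_on_ball"
proof (rule holomorphic_several_restrict)
  show "holomorphic_several (\<lambda>z. f z + t * g z) (ball 0 1)"
    unfolding holomorphic_several_def
  proof
    fix z :: "complex ^ 'n" assume z: "z \<in> ball 0 1"
    have "\<exists>a. (f has_derivative (\<lambda>h. \<Sum>i\<in>UNIV. a $ i * h $ i)) (at z within ball 0 1)"
      "\<exists>b. (g has_derivative (\<lambda>h. \<Sum>i\<in>UNIV. b $ i * h $ i)) (at z within ball 0 1)"
      using assms z unfolding holomorphic_on_ball_def holomorphic_several_def by blast+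
    then obtain a b where a: "(f has_derivative (\<lambda>h. \<Sum>i\<in>UNIV. a $ i * h $ i)) (at z within ball 0 1)"
      and b: "(g has_derivative (\<lambda>h. \<Sum>i\<in>UNIV. b $ i * h $ i)) (at z within ball 0 1)"
      by (elim exE)
    have "((\<lambda>z. f z + t * g z) has_derivative
        (\<lambda>h. (\<Sum>i\<in>UNIV. a $ i * h $ i) + t * (\<Sum>i\<in>UNIV. b $ i * h $ i))) (at z within ball 0 1)"
      by (intro has_derivative_add a has_derivative_mult_right b)
    also have "(\<lambda>h. (\<Sum>i\<in>UNIV. a $ i * h $ i) + t * (\<Sum>i\<in>UNIV. b $ i * h $ i))
        = (\<lambda>h. \<Sum>i\<in>UNIV. (\<chi> i. a $ i + t * b $ i) $ i * h $ i)"
      by (simp add: sum.distrib sum_distrib_left distrib_right mult.assoc)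
    finally show "\<exists>v. ((\<lambda>z. f z + t * g z) has_derivative (\<lambda>h. \<Sum>i\<in>UNIV. v $ i * h $ i)) (at z within ball 0 1)"
      by blast
  qed
qed

lemma hardy_norm_bounded:
  fixes f :: "complex ^ 'n \<Rightarrow> complex"
  assumes "0 < p" "0 \<le> B" "continuous_on (ball 0 1) f" "\<And>z. z \<in> ball 0 1 \<Longrightarrow> norm (f z) \<le> B"
  shows "hardy_norm p f < \<infinity>"
proof -
  let ?\<mu> = "measure surface_measure (sphere 0 1 :: (complex ^ 'n) set)"
  \<comment> \<open>Written as a p-th power, the form in which \<open>hardy_norm_leI\<close> takes
    its bound.\<close>
  have "slice_integral p f r \<le> ((B powr p * ?\<mu>) powr (1 / p)) powr p" if "r \<in> {0<..<1}" for r
  proof -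
    have "slice_integral p f r \<le> (\<integral>z. B powr p \<partial>(surface_measure :: (complex ^ 'n) measure))"
      using assms that by (intro integral_mono integrable_slice) (auto intro!: powr_mono2)
    also have "\<dots> = ((B powr p * ?\<mu>) powr (1 / p)) powr p" using assms by (simp add: powr_powr)
    finally show ?thesis .
  qed
  from hardy_norm_leI(1)[OF assms(1) powr_ge_zero this] show ?thesis .
qed

lemma hardy_norm_sum:
  fixes g :: "nat \<Rightarrow> complex ^ 'n \<Rightarrow> complex"
  assumes "1 \<le> p" "\<And>l. continuous_on (ball 0 1) (g l)" "\<And>l. hardy_norm p (g l) < \<infinity>"
  shows "hardy_norm p (\<lambda>z. \<Sum>l<n. g l z) < \<infinity>
    \<and> enn2real (hardy_norm p (\<lambda>z. \<Sum>l<n. g l z)) \<le> (\<Sum>l<n. enn2real (hardy_norm p (g l)))"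
proof (induction n)
  case 0
  have "0 < p" using assms(1) by simp
  then show ?case using hardy_norm_leI[of p 0 "\<lambda>_ :: complex ^ 'n. 0"] by simp
next
  case (Suc n)
  have "continuous_on (ball 0 1) (\<lambda>z. \<Sum>l<n. g l z)" by (intro continuous_intros assms(2))
  from hardy_norm_add[OF assms(1) this assms(2)[of n] conjunct1[OF Suc.IH] assms(3)[of n]] Suc.IH
  show ?case by simp
qed

text \<open>Each slice sees only finitely many humps plus an error of at most 1. Upper bounds come
  from summable H^p norms of the humps, lower bounds from isolating one hump on its own
  slice.\<close>

lemma exists_nowhere_local_hardy:
  assumes q: "1 < q"
  shows "\<exists>h. h \<in> (nowhere_local_hardy q :: (complex ^ 'n \<Rightarrow> complex) set)"
proof -
  let ?S = "surface_measure :: (complex ^ 'n) measure"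
  define \<mu> where "\<mu> = measure ?S (sphere 0 1)"
  have \<mu>: "0 \<le> \<mu>" by (simp add: \<mu>_def)
  obtain c :: "nat \<Rightarrow> complex ^ 'n" and e where ce: "\<And>k. norm (c k) = 1" "\<And>k. 0 < e k"
    "\<And>\<zeta> \<epsilon>. norm \<zeta> = 1 \<Longrightarrow> 0 < \<epsilon> \<Longrightarrow> \<exists>k. ball (c k) (e k) \<subseteq> ball \<zeta> \<epsilon>"
    by (rule countable_cap_base) (rule that; assumption)
  \<comment> \<open>Each cap is treated infinitely often.\<close>
  define C where "C n = ball (c (fst (prod_decode n))) (e (fst (prod_decode n)))" for n
  obtain g :: "nat \<Rightarrow> complex ^ 'n \<Rightarrow> complex" and a B r where
    r01: "\<And>n. 0 < r n \<and> r n < 1" and r_ge: "\<And>n. 1 - 1 / (real n + 1) \<le> r n" and r_Suc: "\<And>n. r n \<le> r (Suc n)"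
    and deriv: "\<And>n z. z \<in> ball 0 1 \<Longrightarrow> (g n has_derivative (\<lambda>h. \<Sum>i\<in>UNIV. a n z $ i * h $ i)) (at z)"
    and B0: "\<And>n. 0 \<le> B n" and B: "\<And>n z. z \<in> ball 0 1 \<Longrightarrow> (\<Sum>l\<le>n. norm (g l z)) \<le> B n"
    and small: "\<And>n z. z \<in> cball 0 (r n) \<Longrightarrow> norm (g (Suc n) z) \<le> (1 / 2) ^ Suc n \<and> norm (a (Suc n) z) \<le> (1 / 2) ^ Suc n"
    and slice: "\<And>n s. s \<in> {0<..<1} \<Longrightarrow>
       slice_integral (q - (q - 1) / (real n + 2)) (g n) s \<le> ((1 / 2) ^ n) powr (q - (q - 1) / (real n + 2))"
    and big: "\<And>n. 2 powr q * (real n + (B n + 1) powr q * \<mu>) < cap_integral q (C n) (g (Suc n)) (r (Suc n))"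
    by (rule hump_sequence[of "\<lambda>n. c (fst (prod_decode n))" "\<lambda>n. e (fst (prod_decode n))" q,
          OF ce(1) ce(2) q, folded \<mu>_def C_def]) (rule that; assumption)
  have C_meas: "C n \<in> sets borel" for n by (simp add: C_def)
  have r_mono: "r n \<le> r m" if "n \<le> m" for n m using r_Suc that by (rule lift_Suc_mono_le)
  have small': "norm (g l z) \<le> (1 / 2) ^ l \<and> norm (a l z) \<le> (1 / 2) ^ l" if "z \<in> cball 0 (r n)" and l: "Suc n \<le> l" for l n z
  proof -
    obtain k where k: "l = Suc k" "n \<le> k" using l by (cases l) auto
    have "z \<in> cball 0 (r k)" using that(1) r_mono[OF k(2)] by simp
    then show ?thesis using small[of z k] k by blast
  qed
  have r_ex: "\<exists>n. x < r n" if x: "x < 1" for x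
  proof -
    obtain n where "1 / real (Suc n) < 1 - x" using nat_approx_posE[of "1 - x"] x by auto
    then have "x < 1 - 1 / (real n + 1)" by (simp add: add.commute)
    then show ?thesis using r_ge[of n] by (intro exI[of _ n]) linarith
  qed
  have cont: "continuous_on (ball 0 1) (g l)" for l
    unfolding continuous_on_eq_continuous_within
    using deriv by (blast intro: continuous_at_imp_continuous_within has_derivative_continuous)
  define H where "H z = (\<Sum>l. g l z)" for z
  define S where "S n z = (\<Sum>l<n. g l z)" for n z
  \<comment> \<open>\<open>S (Suc n)\<close> stops at hump n; the omitted ones start at
    \<open>Suc n\<close>, exactly those small on \<open>cball 0 (r n)\<close>.\<close>
  have tail: "norm (H z - S (Suc n) z) \<le> 1" if "z \<in> cball 0 (r n)" for n z
  proof -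
    have "norm (H z - S (Suc n) z) \<le> 2 * (1 / 2) ^ Suc n"
      unfolding H_def S_def using small'[OF that] by (intro geometric_tail) auto
    also have "\<dots> \<le> 1" by (simp add: power_le_one)
    finally show ?thesis .
  qed
  have hol: "holomorphic_several H (ball 0 1)"
    unfolding H_def
  proof (rule holomorphic_several_suminf[OF deriv])
    fix z :: "complex ^ 'n" assume "z \<in> ball 0 1"
    then obtain n where n: "norm z < r n" using r_ex[of "norm z"] by auto
    show "\<exists>s m. norm z < s \<and> s \<le> 1 \<and>
        (\<forall>w\<in>ball 0 s. \<forall>l\<ge>m. norm (g l w) \<le> (1 / 2) ^ l \<and> norm (a l w) \<le> (1 / 2) ^ l)"
      using n r01[of n] small'[of _ n] by (intro exI[of _ "r n"] exI[of _ "Suc n"]) auto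
  qed auto
  define h where "h = restrict H (ball 0 1)"
  have h: "h \<in> holomorphic_on_ball" unfolding h_def by (rule holomorphic_several_restrict[OF hol])
  have h_eq: "h z = H z" if "z \<in> ball 0 1" for z using that by (simp add: h_def)
  have cont_h: "continuous_on (ball 0 1) h" by (rule holomorphic_on_ball_continuous[OF h])
  have cont_S: "continuous_on (ball 0 1) (S n)" for n
    unfolding S_def by (intro continuous_intros cont)
  have "hardy_norm p h < \<infinity>" if p: "1 \<le> p" "p < q" for p
  proof -
    have fin: "hardy_norm p (g l) < \<infinity>" for l
    proof (rule hardy_norm_bounded[of p "B l"])
      fix z :: "complex ^ 'n" assume "z \<in> ball 0 1"
      have "norm (g l z) \<le> (\<Sum>l\<le>l. norm (g l z))" by (intro member_le_sum) auto
      then show "norm (g l z) \<le> B l" using B[OF \<open>z \<in> ball 0 1\<close>, of l] by linarith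
    qed (use p B0 cont in auto)
    \<comment> \<open>From index \<open>N\<close> on, the exponent used for the hump is at least p,
      so its slice bound passes down to p. The finitely many earlier humps have finite norm because
      they are bounded.\<close>
    obtain N :: nat where N: "(q - 1) / (q - p) \<le> real N" using real_arch_simple by blast
    have le: "enn2real (hardy_norm p (g l)) \<le> (1 / 2) ^ l * (\<mu> + 1)" if "N \<le> l" for l
    proof (rule hardy_norm_leI)
      fix s :: real assume s: "s \<in> {0<..<1}"
      have "(q - 1) / (q - p) \<le> real l + 2" using N that by simp
      then have "p \<le> q - (q - 1) / (real l + 2)" using p by (simp add: field_simps)
      then have "slice_integral p (g l) s \<le> ((1 / 2) ^ l) powr p * (\<mu> + 1)"
        unfolding \<mu>_def using p by (intro slice_integral_lower_exponent[OF cont s _ _ _ slice[OF s]]) auto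
      also have "\<dots> \<le> ((1 / 2) ^ l) powr p * (\<mu> + 1) powr p"
        using \<mu> p powr_mono[of 1 p "\<mu> + 1"] by (intro mult_left_mono) auto
      also have "\<dots> = ((1 / 2) ^ l * (\<mu> + 1)) powr p" by (simp add: powr_mult)
      finally show "slice_integral p (g l) s \<le> ((1 / 2) ^ l * (\<mu> + 1)) powr p" .
    qed (use p \<mu> in auto)
    have summ: "summable (\<lambda>l. enn2real (hardy_norm p (g l)))"
    proof (rule summable_comparison_test'[of "\<lambda>l. (1 / 2) ^ l * (\<mu> + 1)" N])
      show "summable (\<lambda>l. (1 / 2) ^ l * (\<mu> + 1))" by (intro summable_mult2 summable_geometric) simp
    qed (use le in simp)
    define K where "K = (\<Sum>l. enn2real (hardy_norm p (g l)))"
    have K0: "0 \<le> K" unfolding K_def by (intro suminf_nonneg summ) simp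
    have S_le: "slice_integral p (S n) s \<le> K powr p" if s: "s \<in> {0<..<1}" for n s
    proof -
      note hs = hardy_norm_sum[of p g n, OF p(1) cont fin, folded S_def]
      have "enn2real (hardy_norm p (S n)) \<le> K"
        using conjunct2[OF hs] sum_le_suminf[OF summ, of "{..<n}"] by (simp add: K_def)
      then have "enn2real (hardy_norm p (S n)) powr p \<le> K powr p"
        using p by (intro powr_mono2) auto
      moreover have "slice_integral p (S n) s \<le> enn2real (hardy_norm p (S n)) powr p"
        by (rule slice_integral_le_hardy_norm[OF conjunct1[OF hs] _ s]) (use p in simp)
      ultimately show ?thesis by linarith
    qed
    \<comment> \<open>The index n depends on \<open>s\<close>, but \<open>K\<close> bounds the H^p
      norms of all partial sums.\<close>
    have "slice_integral p h s \<le> ((2 powr p * (K powr p + \<mu>)) powr (1 / p)) powr p" if s: "s \<in> {0<..<1}" for s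
    proof -
      obtain n where n: "s < r n" using r_ex[of s] s by auto
      have "slice_integral p h s \<le> (\<integral>z. 2 powr p * (norm (S (Suc n) (s *\<^sub>R z)) powr p + 1) \<partial>?S)"
      proof (intro integral_mono integrable_slice cont_h s)
        show "integrable ?S (\<lambda>z. 2 powr p * (norm (S (Suc n) (s *\<^sub>R z)) powr p + 1))"
          using p by (intro integrable_mult_right Bochner_Integration.integrable_add integrable_slice cont_S s) auto
        fix z assume z: "z \<in> space ?S"
        have "norm (H (s *\<^sub>R z)) \<le> norm (S (Suc n) (s *\<^sub>R z)) + 1"
          using tail[of "s *\<^sub>R z" n] norm_triangle_ineq2[of "H (s *\<^sub>R z)" "S (Suc n) (s *\<^sub>R z)"] z s n by simp
        then have "norm (h (s *\<^sub>R z)) powr p \<le> (norm (S (Suc n) (s *\<^sub>R z)) + 1) powr p"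
          using p z s by (intro powr_mono2) (auto simp: h_eq)
        also have "\<dots> \<le> 2 powr p * (norm (S (Suc n) (s *\<^sub>R z)) powr p + 1 powr p)"
          using p by (intro powr_add_le) auto
        finally show "norm (h (s *\<^sub>R z)) powr p \<le> 2 powr p * (norm (S (Suc n) (s *\<^sub>R z)) powr p + 1)" by simp
      qed (use p in simp)
      also have "\<dots> = 2 powr p * (slice_integral p (S (Suc n)) s + \<mu>)"
        using integrable_slice[OF cont_S s, of p "Suc n"] p by (simp add: \<mu>_def)
      also have "\<dots> \<le> 2 powr p * (K powr p + \<mu>)" using S_le[OF s] by (intro mult_left_mono add_mono) auto
      also have "\<dots> = ((2 powr p * (K powr p + \<mu>)) powr (1 / p)) powr p" using p \<mu> by (simp add: powr_powr)
      finally show ?thesis .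
    qed
    from hardy_norm_leI(1)[OF _ powr_ge_zero this] show ?thesis using p by simp
  qed
  then have "h \<in> hardy_inter q" by (intro hardy_interI h)
  \<comment> \<open>Solve for the hump: g_(n+1) is h minus the tail minus the earlier humps. The
    last two are at most 1 and \<open>B n\<close> on this slice, which is what \<open>big\<close>
    was calibrated for.\<close>
  moreover have "real n < cap_integral q (C n) h (r (Suc n))" for n
  proof -
    have rS: "r (Suc n) \<in> {0<..<1}" using r01 by simp
    have q0: "0 < q" using q by simp
    let ?i = "indicator (sphere 0 1 \<inter> C n) :: complex ^ 'n \<Rightarrow> real"
    have "cap_integral q (C n) (g (Suc n)) (r (Suc n))
        \<le> (\<integral>z. 2 powr q * (?i z * norm (h (r (Suc n) *\<^sub>R z)) powr q + (B n + 1) powr q) \<partial>?S)"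
      unfolding cap_integral_eq
    proof (intro integral_mono integrable_cap cont rS q0 C_meas)
      show "integrable ?S (\<lambda>z. 2 powr q * (?i z * norm (h (r (Suc n) *\<^sub>R z)) powr q + (B n + 1) powr q))"
        by (intro integrable_mult_right Bochner_Integration.integrable_add integrable_cap cont_h rS q0 C_meas) simp
      fix z assume "z \<in> space ?S"
      then have w: "r (Suc n) *\<^sub>R z \<in> cball 0 (r (Suc n))" "r (Suc n) *\<^sub>R z \<in> ball 0 1"
        using r01[of "Suc n"] by auto
      define w where "w = r (Suc n) *\<^sub>R z"
      have "norm (\<Sum>l\<le>n. g l w) \<le> B n" using order_trans[OF norm_sum B[OF w(2)]] by (simp add: w_def)
      moreover have "norm (H w - S (Suc (Suc n)) w) \<le> 1" using tail[OF w(1)] by (simp add: w_def)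
      moreover have "g (Suc n) w = h w - (H w - S (Suc (Suc n)) w) - (\<Sum>l\<le>n. g l w)"
        using h_eq[OF w(2)] by (simp add: S_def w_def lessThan_Suc_atMost)
      moreover have "norm (h w - (H w - S (Suc (Suc n)) w) - (\<Sum>l\<le>n. g l w))
          \<le> norm (h w) + norm (H w - S (Suc (Suc n)) w) + norm (\<Sum>l\<le>n. g l w)"
        by (intro order_trans[OF norm_triangle_ineq4] add_mono norm_triangle_ineq4 order_refl)
      ultimately have "norm (g (Suc n) w) \<le> norm (h w) + (B n + 1)" by simp
      then have "norm (g (Suc n) w) powr q \<le> (norm (h w) + (B n + 1)) powr q"
        using q by (intro powr_mono2) auto
      also have "\<dots> \<le> 2 powr q * (norm (h w) powr q + (B n + 1) powr q)"
        using q B0[of n] by (intro powr_add_le) auto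
      finally show "?i z * norm (g (Suc n) (r (Suc n) *\<^sub>R z)) powr q
          \<le> 2 powr q * (?i z * norm (h (r (Suc n) *\<^sub>R z)) powr q + (B n + 1) powr q)"
        unfolding w_def by (cases "z \<in> sphere 0 1 \<inter> C n") simp_all
    qed
    also have "\<dots> = 2 powr q * (cap_integral q (C n) h (r (Suc n)) + (B n + 1) powr q * \<mu>)"
      using integrable_cap[OF cont_h rS q0 C_meas, of n] unfolding cap_integral_eq by (simp add: \<mu>_def)
    finally have "2 powr q * (real n + (B n + 1) powr q * \<mu>)
        < 2 powr q * (cap_integral q (C n) h (r (Suc n)) + (B n + 1) powr q * \<mu>)"
      using big[of n] by (rule less_le_trans[rotated])
    then show ?thesis by simp
  qed
  note lower = this
  moreover have "h \<notin> local_hardy_space q (sphere 0 1 \<inter> ball \<zeta> \<epsilon>)" if \<zeta>: "norm \<zeta> = 1" "0 < \<epsilon>" for \<zeta> \<epsilon>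
  proof
    assume "h \<in> local_hardy_space q (sphere 0 1 \<inter> ball \<zeta> \<epsilon>)"
    then obtain M where M: "\<And>s. s \<in> {0<..<1} \<Longrightarrow> cap_integral q (ball \<zeta> \<epsilon>) h s \<le> M"
      unfolding local_hardy_space_iff[OF h] by blast
    obtain k where k: "ball (c k) (e k) \<subseteq> ball \<zeta> \<epsilon>" using ce(3)[OF \<zeta>] by blast
    obtain m :: nat where m: "M \<le> real m" using real_arch_simple by blast
    \<comment> \<open>The first component selects the cap, the second makes n at least the supposed
      bound.\<close>
    define n where "n = prod_encode (k, m)"
    have "m \<le> n" unfolding n_def by (rule le_prod_encode_2)
    have "real n < cap_integral q (C n) h (r (Suc n))" by (rule lower)
    also have "\<dots> \<le> cap_integral q (ball \<zeta> \<epsilon>) h (r (Suc n))"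
      using k q r01[of "Suc n"] by (intro cap_integral_mono cont_h) (auto simp: C_def n_def)
    also have "\<dots> \<le> M" using r01[of "Suc n"] by (intro M) auto
    finally show False using m \<open>m \<le> n\<close> by simp
  qed
  ultimately have "h \<in> nowhere_local_hardy q" by (auto simp: nowhere_local_hardy_def)
  then show ?thesis by blast
qed

section \<open>The metric and the perturbation argument\<close>

definition saturate :: "real \<Rightarrow> real" where
  "saturate x = x / (1 + x)"

lemma saturate_bounds:
  assumes "0 \<le> x" shows "0 \<le> saturate x" "saturate x \<le> 1"
  using assms by (auto simp: saturate_def)

lemma saturate_le_iff:
  assumes "0 \<le> x" "0 \<le> y" shows "saturate x \<le> saturate y \<longleftrightarrow> x \<le> y"
  using assms by (simp add: saturate_def divide_le_eq le_divide_eq field_simps)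

text \<open>Splitting the numerator and then shrinking each denominator; this is the triangle
  inequality of the metric, term by term.\<close>

lemma saturate_add_le:
  assumes "0 \<le> x" "0 \<le> y" shows "saturate (x + y) \<le> saturate x + saturate y"
proof -
  have "x / (1 + (x + y)) \<le> x / (1 + x)" "y / (1 + (x + y)) \<le> y / (1 + y)"
    using assms by (auto intro!: divide_left_mono mult_pos_pos)
  then show ?thesis by (simp add: saturate_def add_divide_distrib)
qed

lemma hardy_dist_eq:
  "hardy_dist p f g = (\<Sum>j. (1 / 2) ^ Suc j * saturate (enn2real (hardy_norm (p j) (\<lambda>z. f z - g z))))"
  by (simp add: hardy_dist_def saturate_def Let_def)

lemma summable_saturate:
  assumes "\<And>j. 0 \<le> x j"
  shows "summable (\<lambda>j. (1 / 2) ^ Suc j * saturate (x j))"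
proof (rule summable_comparison_test')
  show "summable (\<lambda>j. (1 / 2 :: real) ^ Suc j)" by (simp add: summable_geometric)
  show "norm ((1 / 2) ^ Suc j * saturate (x j)) \<le> (1 / 2) ^ Suc j" for j
    using saturate_bounds[OF assms, of j] by (simp add: mult_left_le)
qed

lemma hardy_dist_le:
  assumes "\<And>j. enn2real (hardy_norm (p j) (\<lambda>z. f z - g z)) \<le> x j"
  shows "hardy_dist p f g \<le> (\<Sum>j. (1 / 2) ^ Suc j * saturate (x j))"
proof -
  have x: "0 \<le> x j" for j using assms[of j] enn2real_nonneg order_trans by blast
  show ?thesis unfolding hardy_dist_eq
    using assms x by (intro suminf_le summable_saturate mult_left_mono) (auto simp: saturate_le_iff)
qed

text \<open>With \<open>j = 0\<close> a single exponent decides: both definiteness of the metric and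
  openness go through the norm for \<open>p 0\<close>.\<close>

lemma saturate_le_hardy_dist:
  "(1 / 2) ^ Suc j * saturate (enn2real (hardy_norm (p j) (\<lambda>z. f z - g z))) \<le> hardy_dist p f g"
proof -
  have "sum (\<lambda>j. (1 / 2) ^ Suc j * saturate (enn2real (hardy_norm (p j) (\<lambda>z. f z - g z)))) {j} \<le> hardy_dist p f g"
    unfolding hardy_dist_eq
    by (intro sum_le_suminf summable_saturate) (auto intro!: mult_nonneg_nonneg saturate_bounds)
  then show ?thesis by simp
qed

lemma Metric_space_hardy:
  fixes p :: "nat \<Rightarrow> real"
  assumes p: "\<And>j. 1 < p j \<and> p j < q"
  shows "Metric_space (hardy_inter q :: (complex ^ 'n \<Rightarrow> complex) set) (hardy_dist p)"
proof
  fix f g :: "complex ^ 'n \<Rightarrow> complex"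
  show "0 \<le> hardy_dist p f g"
    unfolding hardy_dist_eq
    by (intro suminf_nonneg summable_saturate mult_nonneg_nonneg saturate_bounds) auto
  show "hardy_dist p f g = hardy_dist p g f"
    by (simp add: hardy_dist_eq hardy_norm_def norm_minus_commute)
next
  have q: "1 < q" using p[of 0] by simp
  fix f g :: "complex ^ 'n \<Rightarrow> complex" assume f: "f \<in> hardy_inter q" and g: "g \<in> hardy_inter q"
  show "hardy_dist p f g = 0 \<longleftrightarrow> f = g"
  proof
    assume "hardy_dist p f g = 0"
    then have "saturate (enn2real (hardy_norm (p 0) (\<lambda>z. f z - g z))) \<le> saturate 0"
      using saturate_le_hardy_dist[of 0 p f g] by (simp add: saturate_def[of 0])
    then have "enn2real (hardy_norm (p 0) (\<lambda>z. f z - g z)) \<le> 0"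
      by (subst (asm) saturate_le_iff) auto
    then have "enn2real (hardy_norm (p 0) (\<lambda>z. f z - g z)) = 0"
      by (intro antisym) auto
    moreover have "hardy_norm (p 0) (\<lambda>z. f z - g z) < \<infinity>"
      using p[of 0] by (intro hardy_norm_diff[OF f g]) auto
    ultimately have 0: "hardy_norm (p 0) (\<lambda>z. f z - g z) = 0"
      by (auto simp: enn2real_eq_0_iff)
    show "f = g"
    proof
      fix z show "f z = g z"
      proof (cases "z \<in> ball 0 1")
        case True
        have "f z - g z = 0"
          by (rule hardy_norm_eq_0_imp[OF _ _ 0 True])
            (use p[of 0] q in \<open>auto intro!: continuous_intros hardy_interD(2)[OF f q] hardy_interD(2)[OF g q]\<close>)
        then show ?thesis by simp
      next
        \<comment> \<open>Outside the ball both functions are \<open>undefined\<close> by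
          extensionality.\<close>
        case False
        then show ?thesis using hardy_interD(1)[OF f q] hardy_interD(1)[OF g q]
          by (auto simp: holomorphic_on_ball_def extensional_def)
      qed
    qed
  next
    assume "f = g"
    have "0 < p j" for j using p[of j] by simp
    then have "enn2real (hardy_norm (p j) (\<lambda>z. f z - g z)) = 0" for j
      using hardy_norm_leI(2)[of "p j" 0 "\<lambda>z. f z - g z"] \<open>f = g\<close> by (intro antisym) simp_all
    then show "hardy_dist p f g = 0" by (simp add: hardy_dist_eq saturate_def)
  qed
next
  have q: "1 < q" using p[of 0] by simp
  fix f g h :: "complex ^ 'n \<Rightarrow> complex"
  assume f: "f \<in> hardy_inter q" and g: "g \<in> hardy_inter q" and h: "h \<in> hardy_inter q"
  let ?x = "\<lambda>j. enn2real (hardy_norm (p j) (\<lambda>z. f z - g z))"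
  let ?y = "\<lambda>j. enn2real (hardy_norm (p j) (\<lambda>z. g z - h z))"
  have "hardy_dist p f h \<le> (\<Sum>j. (1 / 2) ^ Suc j * saturate (?x j + ?y j))"
  proof (rule hardy_dist_le)
    fix j
    have "enn2real (hardy_norm (p j) (\<lambda>z. (f z - g z) + (g z - h z))) \<le> ?x j + ?y j"
      using p[of j] hardy_interD(2)[OF f q] hardy_interD(2)[OF g q] hardy_interD(2)[OF h q]
      by (intro hardy_norm_add hardy_norm_diff[OF f g] hardy_norm_diff[OF g h] continuous_intros) auto
    then show "enn2real (hardy_norm (p j) (\<lambda>z. f z - h z)) \<le> ?x j + ?y j" by simp
  qed
  also have "\<dots> \<le> (\<Sum>j. (1 / 2) ^ Suc j * saturate (?x j) + (1 / 2) ^ Suc j * saturate (?y j))"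
  proof (intro suminf_le summable_add summable_saturate enn2real_nonneg add_nonneg_nonneg)
    fix j
    show "(1 / 2) ^ Suc j * saturate (?x j + ?y j) \<le> (1 / 2) ^ Suc j * saturate (?x j) + (1 / 2) ^ Suc j * saturate (?y j)"
      unfolding distrib_left[symmetric] by (intro mult_left_mono saturate_add_le enn2real_nonneg) simp
  qed
  also have "\<dots> = hardy_dist p f g + hardy_dist p g h"
    unfolding hardy_dist_eq by (intro suminf_add[symmetric] summable_saturate) auto
  finally show "hardy_dist p f h \<le> hardy_dist p f g + hardy_dist p g h" .
qed

section \<open>Perturbations along a line\<close>

lemma hardy_inter_add_mult:
  assumes q: "1 < q" and f: "f \<in> hardy_inter q" and h: "h \<in> hardy_inter q"
  shows "(\<lambda>z\<in>ball 0 1. f z + t * h z) \<in> hardy_inter q"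
proof (rule hardy_interI)
  show "(\<lambda>z\<in>ball 0 1. f z + t * h z) \<in> holomorphic_on_ball"
    by (intro holomorphic_on_ball_add_mult hardy_interD(1)[OF _ q] f h)
  fix s assume s: "1 \<le> s" "s < q"
  have "hardy_norm s (\<lambda>z. f z + t * h z) < \<infinity>"
    using s by (intro hardy_norm_add hardy_norm_mult continuous_intros hardy_interD(2,3)[OF _ q] f h) auto
  then show "hardy_norm s (\<lambda>z\<in>ball 0 1. f z + t * h z) < \<infinity>"
    by (subst hardy_norm_cong[where g = "\<lambda>z. f z + t * h z"]) auto
qed

text \<open>The norms of \<open>h\<close> may be unbounded as \<open>p j\<close> tends to q, so the
  terms need not tend to 0 uniformly in j. Saturation bounds them by the weights, and Tannery's
  theorem interchanges limit and sum.\<close>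

lemma hardy_dist_perturbation_tendsto:
  fixes f h :: "complex ^ 'n \<Rightarrow> complex"
  assumes p: "\<And>j. 1 < p j \<and> p j < q" and h: "h \<in> hardy_inter q" and \<epsilon>: "0 < \<epsilon>"
  obtains t\<^sub>0 where "0 < t\<^sub>0"
    "\<And>t. 0 < t \<Longrightarrow> t < t\<^sub>0 \<Longrightarrow> hardy_dist p f (\<lambda>z\<in>ball 0 1. f z + of_real t * h z) < \<epsilon>"
proof -
  have q: "1 < q" using p[of 0] by simp
  define x where "x j = enn2real (hardy_norm (p j) h)" for j
  have le: "hardy_dist p f (\<lambda>z\<in>ball 0 1. f z + of_real t * h z) \<le> (\<Sum>j. (1 / 2) ^ Suc j * saturate (t * x j))"
    if "0 < t" for t
  proof (rule hardy_dist_le)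
    fix j
    have "hardy_norm (p j) (\<lambda>z. f z - (\<lambda>z\<in>ball 0 1. f z + of_real t * h z) z)
        = hardy_norm (p j) (\<lambda>z. of_real (- t) * h z)"
      by (rule hardy_norm_cong) simp
    then show "enn2real (hardy_norm (p j) (\<lambda>z. f z - (\<lambda>z\<in>ball 0 1. f z + of_real t * h z) z)) \<le> t * x j"
      using hardy_norm_mult(2)[of "p j" h "of_real (- t)"] hardy_interD(3)[OF h q, of "p j"] p[of j] that
      by (simp add: x_def)
  qed
  have "((\<lambda>t. \<Sum>j. (1 / 2) ^ Suc j * saturate (t * x j)) \<longlongrightarrow> (\<Sum>j. 0)) (at_right 0)"
  proof (rule tannerys_theorem[where M = "\<lambda>j. (1 / 2) ^ Suc j", THEN conjunct2, THEN conjunct2])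
    fix j
    have "((\<lambda>t. (1 / 2) ^ Suc j * (t * x j / (1 + t * x j))) \<longlongrightarrow> (1 / 2) ^ Suc j * (0 * x j / (1 + 0 * x j))) (at_right 0)"
      by (intro tendsto_intros) auto
    then show "((\<lambda>t. (1 / 2) ^ Suc j * saturate (t * x j)) \<longlongrightarrow> 0) (at_right 0)"
      by (simp add: saturate_def)
  next
    have "\<forall>\<^sub>F t in at_right 0. (0::real) < t" by (rule eventually_at_right_less)
    then have "\<forall>\<^sub>F (j :: nat, t) in at_top \<times>\<^sub>F at_right 0. (0::real) < t"
      using eventually_prod2[of "at_top :: nat filter" "\<lambda>t. (0::real) < t" "at_right 0"] by simp
    then show "\<forall>\<^sub>F (j, t) in at_top \<times>\<^sub>F at_right 0. norm ((1 / 2) ^ Suc j * saturate (t * x j)) \<le> (1 / 2) ^ Suc j"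
    proof (rule eventually_mono, clarify)
      fix j :: nat and t :: real assume "0 < t"
      then have "0 \<le> saturate (t * x j)" "saturate (t * x j) \<le> 1"
        by (auto intro!: saturate_bounds simp: x_def)
      then show "norm ((1 / 2) ^ Suc j * saturate (t * x j)) \<le> (1 / 2) ^ Suc j" by (simp add: mult_left_le)
    qed
  qed (simp_all add: summable_geometric)
  then have "\<forall>\<^sub>F t in at_right 0. (\<Sum>j. (1 / 2) ^ Suc j * saturate (t * x j)) < \<epsilon>"
    using \<epsilon> by (intro order_tendstoD) auto
  then obtain t\<^sub>0 where "0 < t\<^sub>0" "\<And>t. 0 < t \<Longrightarrow> t < t\<^sub>0 \<Longrightarrow> (\<Sum>j. (1 / 2) ^ Suc j * saturate (t * x j)) < \<epsilon>"
    unfolding eventually_at_right_field by blast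
  then show ?thesis using le by (intro that[of t\<^sub>0]) force+
qed

lemma local_hardy_space_mono:
  assumes "f \<in> holomorphic_on_ball" "f \<in> local_hardy_space q (sphere 0 1 \<inter> B)"
    "A \<subseteq> B" "A \<in> sets borel" "B \<in> sets borel" "0 < q"
  shows "f \<in> local_hardy_space q (sphere 0 1 \<inter> A)"
proof -
  obtain M where "\<forall>r\<in>{0<..<1}. cap_integral q B f r \<le> M"
    using assms(2) unfolding local_hardy_space_iff[OF assms(1)] by blast
  then have "\<forall>r\<in>{0<..<1}. cap_integral q A f r \<le> M"
    using cap_integral_mono[OF holomorphic_on_ball_continuous[OF assms(1)] _ assms(6,4,5,3)] order_trans by blast
  then show ?thesis unfolding local_hardy_space_iff[OF assms(1)] by blast
qed

text \<open>\<open>h\<close> is the difference of the two members divided by \<open>s - t\<close>;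
  the constant \<open>K\<close> collects that factor and the one from
  \<open>powr_add_le\<close>.\<close>

lemma local_hardy_space_line:
  assumes f: "f \<in> holomorphic_on_ball" and h: "h \<in> holomorphic_on_ball" and "0 < q" and A: "A \<in> sets borel"
    and s: "(\<lambda>z\<in>ball 0 1. f z + s * h z) \<in> local_hardy_space q (sphere 0 1 \<inter> A)"
    and t: "(\<lambda>z\<in>ball 0 1. f z + t * h z) \<in> local_hardy_space q (sphere 0 1 \<inter> A)"
    and "s \<noteq> t"
  shows "h \<in> local_hardy_space q (sphere 0 1 \<inter> A)"
proof -
  define F where "F u = (\<lambda>z\<in>ball 0 1. f z + u * h z)" for u
  have hol: "F u \<in> holomorphic_on_ball" for u unfolding F_def by (rule holomorphic_on_ball_add_mult[OF f h])
  have cont: "continuous_on (ball 0 1) (F u)" for u by (rule holomorphic_on_ball_continuous[OF hol])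
  obtain M M' where M: "\<And>r. r \<in> {0<..<1} \<Longrightarrow> cap_integral q A (F s) r \<le> M"
    and M': "\<And>r. r \<in> {0<..<1} \<Longrightarrow> cap_integral q A (F t) r \<le> M'"
    using s t unfolding F_def[symmetric] local_hardy_space_iff[OF hol] by blast
  define K where "K = inverse (norm (s - t)) powr q * 2 powr q"
  have "cap_integral q A h r \<le> K * (M + M')" if r: "r \<in> {0<..<1}" for r
  proof -
    let ?i = "indicator (sphere 0 1 \<inter> A) :: complex ^ 'a \<Rightarrow> real"
    have "cap_integral q A h r \<le> (\<integral>z. K * (?i z * norm (F s (r *\<^sub>R z)) powr q + ?i z * norm (F t (r *\<^sub>R z)) powr q) \<partial>surface_measure)"
      unfolding cap_integral_eq
    proof (intro integral_mono integrable_cap holomorphic_on_ball_continuous h r assms)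
      show "integrable surface_measure (\<lambda>z. K * (?i z * norm (F s (r *\<^sub>R z)) powr q + ?i z * norm (F t (r *\<^sub>R z)) powr q))"
        by (intro integrable_mult_right Bochner_Integration.integrable_add integrable_cap cont r assms)
      fix z :: "complex ^ 'a" assume "z \<in> space surface_measure"
      then have w: "r *\<^sub>R z \<in> ball 0 1" using r by simp
      define w where "w = r *\<^sub>R z"
      have "F s w - F t w = (s - t) * h w" using w by (simp add: F_def w_def algebra_simps)
      then have "h w = inverse (s - t) * (F s w - F t w)" using \<open>s \<noteq> t\<close> by simp
      then have "norm (h w) = inverse (norm (s - t)) * norm (F s w - F t w)" by (simp add: norm_mult norm_inverse)
      also have "\<dots> \<le> inverse (norm (s - t)) * (norm (F s w) + norm (F t w))"
        by (intro mult_left_mono norm_triangle_ineq4) auto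
      finally have "norm (h w) powr q \<le> (inverse (norm (s - t)) * (norm (F s w) + norm (F t w))) powr q"
        using \<open>0 < q\<close> by (intro powr_mono2) auto
      also have "\<dots> = inverse (norm (s - t)) powr q * (norm (F s w) + norm (F t w)) powr q" by (rule powr_mult)
      also have "\<dots> \<le> inverse (norm (s - t)) powr q * (2 powr q * (norm (F s w) powr q + norm (F t w) powr q))"
        using \<open>0 < q\<close> by (intro mult_left_mono powr_add_le) auto
      finally have "norm (h w) powr q \<le> K * (norm (F s w) powr q + norm (F t w) powr q)" by (simp add: K_def)
      then show "?i z * norm (h (r *\<^sub>R z)) powr q
          \<le> K * (?i z * norm (F s (r *\<^sub>R z)) powr q + ?i z * norm (F t (r *\<^sub>R z)) powr q)"
        unfolding w_def by (cases "z \<in> sphere 0 1 \<inter> A") simp_all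
    qed
    also have "\<dots> = K * (cap_integral q A (F s) r + cap_integral q A (F t) r)"
      using integrable_cap[OF cont r \<open>0 < q\<close> A] unfolding cap_integral_eq by simp
    also have "\<dots> \<le> K * (M + M')" using M[OF r] M'[OF r] by (intro mult_left_mono add_mono) (auto simp: K_def)
    finally show ?thesis .
  qed
  then show ?thesis unfolding local_hardy_space_iff[OF h] by blast
qed

text \<open>The tangent inequality is one-sided: its slope is taken at \<open>f\<close>, which is
  bounded on the slice, so the loss is at most a multiple of the L^1 distance, uniformly in the
  nearby function g.\<close>

lemma openin_cap_integral:
  fixes A :: "(complex ^ 'n) set"
  assumes p: "\<And>j. 1 < p j \<and> p j < q" and A: "A \<in> sets borel" and r: "r \<in> {0<..<1}"
  shows "openin (hardy_topology p q) {f \<in> hardy_inter q. M < cap_integral q A f r}"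
proof -
  interpret H: Metric_space "hardy_inter q :: (complex ^ 'n \<Rightarrow> complex) set" "hardy_dist p"
    by (rule Metric_space_hardy[OF p])
  have q: "1 < q" using p[of 0] by simp
  define \<mu> where "\<mu> = measure surface_measure (sphere 0 1 :: (complex ^ 'n) set)"
  have \<mu>: "0 \<le> \<mu>" by (simp add: \<mu>_def)
  have "\<exists>\<delta>>0. H.mball f \<delta> \<subseteq> {f \<in> hardy_inter q. M < cap_integral q A f r}"
    if f: "f \<in> hardy_inter q" and M: "M < cap_integral q A f r" for f
  proof -
    have cont_f: "continuous_on (ball 0 1) f" by (rule hardy_interD(2)[OF f q])
    have "bounded ((\<lambda>z. f (r *\<^sub>R z)) ` sphere 0 1)"
      by (intro compact_imp_bounded compact_continuous_image continuous_on_slice cont_f r) simp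
    then obtain B where "0 < B" and "\<forall>w\<in>(\<lambda>z. f (r *\<^sub>R z)) ` sphere 0 1. norm w \<le> B"
      unfolding bounded_pos by blast
    then have B: "norm (f (r *\<^sub>R z)) \<le> B" if "norm z = 1" for z using that by auto
    define K where "K = q * B powr (q - 1)"
    have K: "0 \<le> K" using q by (simp add: K_def)
    \<comment> \<open>Chosen so that the possible loss \<open>K * (\<iota> * (\<mu> + 1))\<close>
      stays below the available margin; the added ones keep the denominator positive.\<close>
    define \<iota> where "\<iota> = (cap_integral q A f r - M) / ((K + 1) * (\<mu> + 1))"
    have \<iota>: "0 < \<iota>" using M K \<mu> by (simp add: \<iota>_def)
    have gap: "K * (\<iota> * (\<mu> + 1)) < cap_integral q A f r - M"
    proof -
      have "(K + 1) * (\<iota> * (\<mu> + 1)) = cap_integral q A f r - M" using K \<mu> by (simp add: \<iota>_def)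
      moreover have "K * (\<iota> * (\<mu> + 1)) < (K + 1) * (\<iota> * (\<mu> + 1))" using \<iota> \<mu> by (intro mult_strict_right_mono) auto
      ultimately show ?thesis by linarith
    qed
    \<comment> \<open>1/2 is the weight of the term \<open>j = 0\<close>, so the radius forces the
      norm for \<open>p 0\<close> below \<iota>.\<close>
    have "M < cap_integral q A g r" if g: "g \<in> hardy_inter q" and d: "hardy_dist p f g < 1 / 2 * saturate \<iota>" for g
    proof -
      have cont_g: "continuous_on (ball 0 1) g" by (rule hardy_interD(2)[OF g q])
      have cont_d: "continuous_on (ball 0 1) (\<lambda>z. f z - g z)" by (intro continuous_intros cont_f cont_g)
      let ?N = "enn2real (hardy_norm (p 0) (\<lambda>z. f z - g z))"
      have "saturate ?N < saturate \<iota>" using saturate_le_hardy_dist[of 0 p f g] d by simp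
      then have "?N < \<iota>" using saturate_le_iff[of \<iota> ?N] \<iota> by simp
      then have "?N powr p 0 \<le> \<iota> powr p 0" using p[of 0] by (intro powr_mono2) auto
      moreover have "slice_integral (p 0) (\<lambda>z. f z - g z) r \<le> ?N powr p 0"
        using p[of 0] by (intro slice_integral_le_hardy_norm hardy_norm_diff[OF f g] r) auto
      ultimately have "slice_integral (p 0) (\<lambda>z. f z - g z) r \<le> \<iota> powr p 0" by linarith
      then have "slice_integral 1 (\<lambda>z. f z - g z) r \<le> \<iota> powr 1 * (\<mu> + 1)"
        unfolding \<mu>_def using p[of 0] \<iota> by (intro slice_integral_lower_exponent cont_d r) auto
      then have le: "slice_integral 1 (\<lambda>z. f z - g z) r \<le> \<iota> * (\<mu> + 1)" using \<iota> by simp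
      let ?i = "indicator (sphere 0 1 \<inter> A) :: complex ^ 'n \<Rightarrow> real"
      have "cap_integral q A f r - cap_integral q A g r
          = (\<integral>z. ?i z * norm (f (r *\<^sub>R z)) powr q - ?i z * norm (g (r *\<^sub>R z)) powr q \<partial>surface_measure)"
        unfolding cap_integral_eq using q
        by (intro Bochner_Integration.integral_diff[symmetric] integrable_cap cont_f cont_g r A) auto
      also have "\<dots> \<le> (\<integral>z. K * norm (f (r *\<^sub>R z) - g (r *\<^sub>R z)) powr 1 \<partial>surface_measure)"
      proof (intro integral_mono Bochner_Integration.integrable_diff integrable_cap cont_f cont_g r A integrable_mult_right)
        show "integrable surface_measure (\<lambda>z. norm (f (r *\<^sub>R z) - g (r *\<^sub>R z)) powr 1)"
          using integrable_slice[OF cont_d r, of 1] by simp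
        fix z :: "complex ^ 'n" assume "z \<in> space surface_measure"
        then have nz: "norm z = 1" by simp
        define a b where "a = norm (f (r *\<^sub>R z))" and "b = norm (g (r *\<^sub>R z))"
        have "a powr q - b powr q \<le> q * a powr (q - 1) * (a - b)"
          using q by (intro powr_tangent_le) (auto simp: a_def b_def)
        also have "\<dots> \<le> q * a powr (q - 1) * norm (f (r *\<^sub>R z) - g (r *\<^sub>R z))"
          using q norm_triangle_ineq2[of "f (r *\<^sub>R z)" "g (r *\<^sub>R z)"] by (intro mult_left_mono) (auto simp: a_def b_def)
        also have "\<dots> \<le> K * norm (f (r *\<^sub>R z) - g (r *\<^sub>R z))"
          unfolding K_def using q B[OF nz] by (intro mult_right_mono mult_left_mono powr_mono2) (auto simp: a_def)
        finally show "?i z * norm (f (r *\<^sub>R z)) powr q - ?i z * norm (g (r *\<^sub>R z)) powr q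
            \<le> K * norm (f (r *\<^sub>R z) - g (r *\<^sub>R z)) powr 1"
          using K by (cases "z \<in> sphere 0 1 \<inter> A") (simp_all add: a_def b_def)
      qed (use q in auto)
      also have "\<dots> = K * slice_integral 1 (\<lambda>z. f z - g z) r" by (rule integral_mult_right_zero)
      also have "\<dots> \<le> K * (\<iota> * (\<mu> + 1))" using K le by (intro mult_left_mono)
      finally show ?thesis using gap by linarith
    qed
    moreover have "0 < 1 / 2 * saturate \<iota>" using \<iota> by (simp add: saturate_def)
    ultimately show ?thesis by (intro exI[of _ "1 / 2 * saturate \<iota>"]) auto
  qed
  then show ?thesis unfolding H.openin_mtopology by auto
qed

section \<open>Density and the G-delta property\<close>

theorem theorem2p4:
  fixes q :: real and p :: "nat \<Rightarrow> real"
  assumes "q > 1"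
    and "strict_mono p" and "\<And>j. 1 < p j \<and> p j < q" and "p \<longlonglongrightarrow> q"
  shows "hardy_topology p q closure_of (nowhere_local_hardy q :: (complex ^ 'n \<Rightarrow> complex) set)
           = hardy_inter q
       \<and> gdelta_in (hardy_topology p q) (nowhere_local_hardy q :: (complex ^ 'n \<Rightarrow> complex) set)"
proof -
  note p = assms(3)
  interpret H: Metric_space "hardy_inter q :: (complex ^ 'n \<Rightarrow> complex) set" "hardy_dist p"
    by (rule Metric_space_hardy[OF p])
  have q: "1 < q" "0 < q" using assms(1) by auto
  obtain c :: "nat \<Rightarrow> complex ^ 'n" and e where ce: "\<And>k. norm (c k) = 1" "\<And>k. 0 < e k"
    "\<And>\<zeta> \<epsilon>. norm \<zeta> = 1 \<Longrightarrow> 0 < \<epsilon> \<Longrightarrow> \<exists>k. ball (c k) (e k) \<subseteq> ball \<zeta> \<epsilon>"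
    by (rule countable_cap_base) (rule that; assumption)
  define A where "A k = ball (c k) (e k)" for k
  have A: "A k \<in> sets borel" for k by (simp add: A_def)
  \<comment> \<open>The centres lie on the sphere, so the \<open>A k\<close> are among the balls of
    the definition; conversely monotonicity passes from any ball to a listed one inside it.\<close>
  have nowhere_iff: "g \<in> nowhere_local_hardy q \<longleftrightarrow> g \<in> hardy_inter q \<and> (\<forall>k. g \<notin> local_hardy_space q (sphere 0 1 \<inter> A k))"
    for g :: "complex ^ 'n \<Rightarrow> complex"
  proof
    assume "g \<in> nowhere_local_hardy q"
    then show "g \<in> hardy_inter q \<and> (\<forall>k. g \<notin> local_hardy_space q (sphere 0 1 \<inter> A k))"
      using ce(1,2) by (auto simp: nowhere_local_hardy_def A_def)
  next
    assume g: "g \<in> hardy_inter q \<and> (\<forall>k. g \<notin> local_hardy_space q (sphere 0 1 \<inter> A k))"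
    have "g \<notin> local_hardy_space q (sphere 0 1 \<inter> ball \<zeta> \<epsilon>)" if \<zeta>: "norm \<zeta> = 1" "0 < \<epsilon>" for \<zeta> \<epsilon>
    proof
      assume local: "g \<in> local_hardy_space q (sphere 0 1 \<inter> ball \<zeta> \<epsilon>)"
      obtain k where k: "A k \<subseteq> ball \<zeta> \<epsilon>" using ce(3)[OF \<zeta>] unfolding A_def by blast
      have "g \<in> local_hardy_space q (sphere 0 1 \<inter> A k)"
        by (rule local_hardy_space_mono[OF hardy_interD(1)[OF conjunct1[OF g] q(1)] local k A _ q(2)]) simp
      then show False using g by blast
    qed
    then show "g \<in> nowhere_local_hardy q" using g by (auto simp: nowhere_local_hardy_def)
  qed
  obtain h :: "complex ^ 'n \<Rightarrow> complex" where "h \<in> nowhere_local_hardy q"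
    using exists_nowhere_local_hardy[OF q(1)] by blast
  then have h: "h \<in> hardy_inter q" and h_not: "\<And>k. h \<notin> local_hardy_space q (sphere 0 1 \<inter> A k)"
    unfolding nowhere_iff by auto
  have dense: "\<exists>g\<in>nowhere_local_hardy q. g \<in> H.mball f \<epsilon>" if f: "f \<in> hardy_inter q" and \<epsilon>: "0 < \<epsilon>" for f \<epsilon>
  proof -
    define F where "F t = (\<lambda>z\<in>ball 0 1. f z + complex_of_real t * h z)" for t
    obtain t\<^sub>0 where t0: "0 < t\<^sub>0" "\<And>t. 0 < t \<Longrightarrow> t < t\<^sub>0 \<Longrightarrow> hardy_dist p f (F t) < \<epsilon>"
      by (rule hardy_dist_perturbation_tendsto[where f = f and p = p, OF p h \<epsilon>, folded F_def]) (rule that; assumption)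
    have F: "F t \<in> hardy_inter q" for t unfolding F_def by (rule hardy_inter_add_mult[OF q(1) f h])
    define bad where "bad k = {t. F t \<in> local_hardy_space q (sphere 0 1 \<inter> A k)}" for k
    have "countable (bad k)" for k
    proof -
      have "s = t" if "s \<in> bad k" "t \<in> bad k" for s t
        using local_hardy_space_line[OF hardy_interD(1)[OF f q(1)] hardy_interD(1)[OF h q(1)] q(2) A[of k],
            of "of_real s" "of_real t"] that h_not[of k] unfolding bad_def F_def by auto
      then have "bad k = {} \<or> (\<exists>s. bad k = {s})" by blast
      then show ?thesis by auto
    qed
    then have "countable (\<Union>k. bad k)" by simp
    moreover have "uncountable {0<..<t\<^sub>0}" using t0(1) by (simp add: uncountable_open_interval)
    ultimately have "\<not> {0<..<t\<^sub>0} \<subseteq> (\<Union>k. bad k)" using countable_subset by blast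
    then obtain t where "t \<in> {0<..<t\<^sub>0}" "t \<notin> (\<Union>k. bad k)" by blast
    then have t: "0 < t" "t < t\<^sub>0" "\<And>k. t \<notin> bad k" by auto
    have "F t \<in> nowhere_local_hardy q" using t(3) F unfolding nowhere_iff bad_def by blast
    moreover have "F t \<in> H.mball f \<epsilon>" using t0(2)[OF t(1,2)] f F by simp
    ultimately show ?thesis by blast
  qed
  \<comment> \<open>Only the caps and the bounds are intersected; the radii form a union, so their
    uncountability is harmless.\<close>
  define W where "W k m = (\<Union>r\<in>{0<..<1}. {f \<in> hardy_inter q. real m < cap_integral q (A k) f r})" for k m
  have W: "openin H.mtopology (W k m)" for k m
    unfolding W_def by (intro openin_Union ballI) (auto intro!: openin_cap_integral[where p = p, OF p A])
  have eq: "nowhere_local_hardy q = \<Inter> (range (\<lambda>(k, m). W k m))"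
  proof (intro set_eqI)
    fix g :: "complex ^ 'n \<Rightarrow> complex"
    have "g \<notin> local_hardy_space q (sphere 0 1 \<inter> A k) \<longleftrightarrow> (\<forall>m. g \<in> W k m)" if g: "g \<in> hardy_inter q" for k
    proof -
      \<comment> \<open>Natural numbers as bounds make the intersection countable.\<close>
      have "(\<exists>M. \<forall>r\<in>{0<..<1}. cap_integral q (A k) g r \<le> M) \<longleftrightarrow> (\<exists>m :: nat. \<forall>r\<in>{0<..<1}. cap_integral q (A k) g r \<le> real m)"
        by (meson order_trans real_arch_simple)
      then show ?thesis
        using g unfolding local_hardy_space_iff[OF hardy_interD(1)[OF g q(1)]] by (auto simp: W_def not_le)
    qed
    moreover have "W k m \<subseteq> hardy_inter q" for k m by (auto simp: W_def)
    ultimately show "g \<in> nowhere_local_hardy q \<longleftrightarrow> g \<in> \<Inter> (range (\<lambda>(k, m). W k m))"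
      unfolding nowhere_iff by fastforce
  qed
  have "gdelta_in H.mtopology (nowhere_local_hardy q)"
    unfolding eq by (rule gdelta_in_Inter) (auto intro!: open_imp_gdelta_in W)
  moreover have "H.mtopology closure_of nowhere_local_hardy q = hardy_inter q"
    unfolding H.metric_closure_of using dense by auto
  ultimately show ?thesis by blast
qed

end
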